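(* There exist absolute constants $c>0$ and $c_0\ge 1$ such that for every fast-memory size $M\ge 1$ and every power of two $n\ge c_0\sqrt{M}$, every implementation of Strassen's algorithm on two $n\times n$ matrices in the sequential two-level memory model with fast memory of size $M$, in which no intermediate value is computed twice, moves at least $$c\left(\frac{n}{\sqrt{M}}\right)^{\log_2 7}\cdot M$$ words between slow and fast memory. That is, $IO(n)=\Omega\big((n/\sqrt M)^{\log_2 7} M\big)$. The same holds for Winograd's variant of Strassen's algorithm (which uses 15 rather than 18 block additions per recursion step).
   Context: Strassen's algorithm, for $n\times n$ matrices $A,B$ with $n$ a power of two: if $n=1$, return $C_{11}=A_{11}B_{11}$. Otherwise, split $A,B$ into four $\frac n2\times\frac n2$ blocks and compute $M_1=(A_{11}+A_{22})(B_{11}+B_{22})$, $M_2=(A_{21}+A_{22})B_{11}$, $M_3=A_{11}(B_{12}-B_{22})$, $M_4=A_{22}(B_{21}-B_{11})$, $M_5=(A_{11}+A_{12})B_{22}$, $M_6=(A_{21}-A_{11})(B_{11}+B_{12})$, $M_7=(A_{12}-A_{22})(B_{21}+B_{22})$. The seven block products are computed recursively, and $C_{11}=M_1+M_4-M_5+M_7$, $C_{12}=M_3+M_5$, $C_{21}=M_2+M_4$, $C_{22}=M_1-M_2+M_3+M_6$. All block additions and subtractions are performed entrywise by binary scalar operations. Computation graph (CDAG): a directed acyclic graph with one vertex per input entry and one vertex per scalar arithmetic operation. There is an edge $(u,v)$ whenever the value of $u$ is an operand of the operation $v$. Sequential two-level memory model: - There is a fast memory holding at most $M$ words and an unbounded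 slow memory. - The input matrices initially reside in slow memory, and the outputs must end in slow memory. - A scalar arithmetic operation may be performed only when its operands are in fast memory, and its result is placed in fast memory. - Each word moved from slow to fast memory (read) or from fast to slow memory (write) counts as one unit of communication. An implementation is a schedule of reads, writes and arithmetic operations that computes every vertex of the CDAG exactly once (no recomputation), in an order consistent with the edges. $IO(n)$ denotes the minimum, over all such implementations, of the number of words moved. *)

theory Defs
  imports Complex_Main
begin

text \<open>A matrix of CDAG vertices is a function from (row, column) to vertex ids.
  A generator state is (next free vertex id, list of operation vertices), where an
  operation vertex is recorded as (v, u1, u2): vertex v is a binary scalar operation
  whose operands are the values of vertices u1 and u2 (so the CDAG has the edges
  (u1,v) and (u2,v)).  The kind of operation (+, -, *) is irrelevant for the graph.\<close>

type_synonym vmat = "nat \<Rightarrow> nat \<Rightarrow> nat"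
type_synonym gst = "nat \<times> (nat \<times> nat \<times> nat) list"

definition binop :: "nat \<Rightarrow> nat \<Rightarrow> gst \<Rightarrow> nat \<times> gst" where
  "binop u w st = (fst st, (Suc (fst st), (fst st, u, w) # snd st))"

definition idx :: "nat \<Rightarrow> (nat \<times> nat) list" where
  "idx m = [(i, j). i \<leftarrow> [0..<m], j \<leftarrow> [0..<m]]"

definition madd :: "nat \<Rightarrow> vmat \<Rightarrow> vmat \<Rightarrow> gst \<Rightarrow> vmat \<times> gst" where
  "madd m X Y st =
     fold (\<lambda>(i, j) (R, s). case binop (X i j) (Y i j) s of
             (v, s') \<Rightarrow> (R(i := (R i)(j := v)), s'))
          (idx m) (\<lambda>_ _. 0, st)"

definition blk :: "vmat \<Rightarrow> nat \<Rightarrow> nat \<Rightarrow> nat \<Rightarrow> vmat" where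
  "blk X h a b = (\<lambda>i j. X (a * h + i) (b * h + j))"

definition comb :: "nat \<Rightarrow> vmat \<Rightarrow> vmat \<Rightarrow> vmat \<Rightarrow> vmat \<Rightarrow> vmat" where
  "comb h C11 C12 C21 C22 = (\<lambda>i j.
     if i < h then (if j < h then C11 i j else C12 i (j - h))
     else (if j < h then C21 (i - h) j else C22 (i - h) (j - h)))"

primrec strassen :: "nat \<Rightarrow> vmat \<Rightarrow> vmat \<Rightarrow> gst \<Rightarrow> vmat \<times> gst" where
  "strassen 0 A B st = (case binop (A 0 0) (B 0 0) st of (v, st') \<Rightarrow> (\<lambda>_ _. v, st'))"
| "strassen (Suc k) A B st0 =
    (let h = 2 ^ k;
         A11 = blk A h 0 0; A12 = blk A h 0 1; A21 = blk A h 1 0; A22 = blk A h 1 1;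
         B11 = blk B h 0 0; B12 = blk B h 0 1; B21 = blk B h 1 0; B22 = blk B h 1 1;
         (X1, st1) = madd h A11 A22 st0;  (Y1, st2) = madd h B11 B22 st1;
         (M1, st3) = strassen k X1 Y1 st2;
         (X2, st4) = madd h A21 A22 st3;
         (M2, st5) = strassen k X2 B11 st4;
         (Y3, st6) = madd h B12 B22 st5;
         (M3, st7) = strassen k A11 Y3 st6;
         (Y4, st8) = madd h B21 B11 st7;
         (M4, st9) = strassen k A22 Y4 st8;
         (X5, st10) = madd h A11 A12 st9;
         (M5, st11) = strassen k X5 B22 st10;
         (X6, st12) = madd h A21 A11 st11; (Y6, st13) = madd h B11 B12 st12;
         (M6, st14) = strassen k X6 Y6 st13;
         (X7, st15) = madd h A12 A22 st14; (Y7, st16) = madd h B21 B22 st15;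
         (M7, st17) = strassen k X7 Y7 st16;
         (P1, st18) = madd h M1 M4 st17; (P2, st19) = madd h P1 M5 st18;
         (C11, st20) = madd h P2 M7 st19;
         (C12, st21) = madd h M3 M5 st20;
         (C21, st22) = madd h M2 M4 st21;
         (Q1, st23) = madd h M1 M2 st22; (Q2, st24) = madd h Q1 M3 st23;
         (C22, st25) = madd h Q2 M6 st24
     in (comb h C11 C12 C21 C22, st25))"

primrec winograd :: "nat \<Rightarrow> vmat \<Rightarrow> vmat \<Rightarrow> gst \<Rightarrow> vmat \<times> gst" where
  "winograd 0 A B st = (case binop (A 0 0) (B 0 0) st of (v, st') \<Rightarrow> (\<lambda>_ _. v, st'))"
| "winograd (Suc k) A B st0 =
    (let h = 2 ^ k;
         A11 = blk A h 0 0; A12 = blk A h 0 1; A21 = blk A h 1 0; A22 = blk A h 1 1;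
         B11 = blk B h 0 0; B12 = blk B h 0 1; B21 = blk B h 1 0; B22 = blk B h 1 1;
         (S1, st1) = madd h A21 A22 st0;
         (S2, st2) = madd h S1 A11 st1;
         (S3, st3) = madd h A11 A21 st2;
         (S4, st4) = madd h A12 S2 st3;
         (T1, st5) = madd h B12 B11 st4;
         (T2, st6) = madd h B22 T1 st5;
         (T3, st7) = madd h B22 B12 st6;
         (T4, st8) = madd h T2 B21 st7;
         (M1, st9) = winograd k A11 B11 st8;
         (M2, st10) = winograd k A12 B21 st9;
         (M3, st11) = winograd k S4 B22 st10;
         (M4, st12) = winograd k A22 T4 st11;
         (M5, st13) = winograd k S1 T1 st12;
         (M6, st14) = winograd k S2 T2 st13;
         (M7, st15) = winograd k S3 T3 st14;
         (U1, st16) = madd h M1 M2 st15;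
         (U2, st17) = madd h M1 M6 st16;
         (U3, st18) = madd h U2 M7 st17;
         (U4, st19) = madd h U2 M5 st18;
         (U5, st20) = madd h U4 M3 st19;
         (U6, st21) = madd h U3 M4 st20;
         (U7, st22) = madd h U3 M5 st21
     in (comb h U1 U5 U6 U7, st22))"

text \<open>The CDAG of an algorithm (given as generator) on n x n inputs, n = 2^k:
  (input vertices, operation vertices with their operands, output vertices).
  Inputs: A i j has id i*n+j, B i j has id n*n+i*n+j.\<close>
type_synonym cdag = "nat set \<times> (nat \<times> nat \<times> nat) list \<times> nat set"

definition mk_cdag :: "(nat \<Rightarrow> vmat \<Rightarrow> vmat \<Rightarrow> gst \<Rightarrow> vmat \<times> gst) \<Rightarrow> nat \<Rightarrow> cdag" where
  "mk_cdag alg k =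
     (let n = 2 ^ k;
          r = alg k (\<lambda>i j. i * n + j) (\<lambda>i j. n * n + i * n + j) (2 * n * n, []);
          C = fst r
      in ({..<2 * n * n}, snd (snd r), {C i j | i j. i < n \<and> j < n}))"

definition strassen_cdag :: "nat \<Rightarrow> cdag" where
  "strassen_cdag k = mk_cdag strassen k"

definition winograd_cdag :: "nat \<Rightarrow> cdag" where
  "winograd_cdag k = mk_cdag winograd k"

text \<open>Actions: read a word slow->fast, write a word fast->slow, compute an operation
  vertex (operands in fast memory, result placed in fast memory), discard a word
  from fast memory (free).  Memory state: (fast contents, slow contents, computed).\<close>
datatype action = Read nat | Write nat | Compute nat | Discard nat

type_synonym mstate = "nat set \<times> nat set \<times> nat set"

fun step :: "cdag \<Rightarrow> nat \<Rightarrow> action \<Rightarrow> mstate \<Rightarrow> mstate option" where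
  "step G M (Read v) (F, S, D) =
     (if v \<in> S \<and> card (insert v F) \<le> M then Some (insert v F, S, D) else None)"
| "step G M (Write v) (F, S, D) =
     (if v \<in> F then Some (F, insert v S, D) else None)"
| "step G M (Discard v) (F, S, D) = Some (F - {v}, S, D)"
| "step G M (Compute v) (F, S, D) =
     (if v \<notin> D \<and> (\<exists>u1 u2. (v, u1, u2) \<in> set (fst (snd G)) \<and> u1 \<in> F \<and> u2 \<in> F)
         \<and> card (insert v F) \<le> M
      then Some (insert v F, S, insert v D) else None)"

fun run :: "cdag \<Rightarrow> nat \<Rightarrow> action list \<Rightarrow> mstate \<Rightarrow> mstate option" where
  "run G M [] st = Some st"
| "run G M (a # as) st = (case step G M a st of None \<Rightarrow> None | Some st' \<Rightarrow> run G M as st')"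

text \<open>A valid implementation: starting with empty fast memory and the inputs in slow
  memory, every step is legal, every operation vertex gets computed (at most once,
  since Compute requires the vertex not yet computed, hence exactly once), and at the
  end all outputs are in slow memory.\<close>
definition valid_impl :: "cdag \<Rightarrow> nat \<Rightarrow> action list \<Rightarrow> bool" where
  "valid_impl G M sch \<longleftrightarrow>
     (\<exists>F S D. run G M sch ({}, fst G, fst G) = Some (F, S, D)
        \<and> (\<forall>(v, u1, u2) \<in> set (fst (snd G)). v \<in> D)
        \<and> snd (snd G) \<subseteq> S)"

fun is_io :: "action \<Rightarrow> bool" where
  "is_io (Read _) = True"
| "is_io (Write _) = True"
| "is_io (Compute _) = False"
| "is_io (Discard _) = False"

definition io_cost :: "action list \<Rightarrow> nat" where
  "io_cost sch = length (filter is_io sch)"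

end

theory Submission
  imports Defs
begin

text \<open>
  Call a vertex a cut vertex of a vertex set W if one of its out-edges joins W to its complement.
  If W is the set of vertices computed in a segment of a schedule without recomputation, then a cut
  vertex either lies in fast memory at the beginning or at the end of the segment, or is moved
  during it; so a segment with at least 3 M cut vertices costs at least M words.

  A single recursive product of size N has many cut vertices: if w of its N outputs lie in W, then
  there are at least min(w, N - w) / 4 of them. Indeed, at the top level the seven block products,
  the intermediate sums and the four output blocks form N / 4 disjoint connected gadgets. Let m be
  the number of gadgets that W splits. Every split gadget
  contains a cut vertex, and every block product has at
  least min(w, N - w) / 4 - m outputs on either side of W, which yields the bound by induction.

  Since the 7^(k - r) products of size 2^r are computed on disjoint sets of vertices, their cut
  vertices add up. Now choose r with 4^r of order M, and cut the schedule into segments computing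
  4^r / 2 outputs of these products each: no product has more than half of its outputs in
  one segment.
\<close>

section \<open>Expansion of computation graphs\<close>

definition edges_of :: "(nat \<times> nat \<times> nat) list \<Rightarrow> (nat \<times> nat) set" where
  "edges_of ops = {(a, v). \<exists>u w. (v, u, w) \<in> set ops \<and> (a = u \<or> a = w)}"

text \<open>Sources rather than edges are counted: a value needed across the border of
  \<open>W\<close> has to be kept or moved, however many uses it has there. The cut is a subset of
  \<open>V\<close>, so disjoint vertex sets have disjoint cuts even if edges leave
  \<open>V\<close>.\<close>

definition cut :: "(nat \<times> nat) set \<Rightarrow> nat set \<Rightarrow> nat set \<Rightarrow> nat set" where
  "cut E W V = {a \<in> V. \<exists>v. (a, v) \<in> E \<and> (a \<in> W) \<noteq> (v \<in> W)}"

definition sq :: "nat \<Rightarrow> (nat \<times> nat) set" where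
  "sq n = {..<n} \<times> {..<n}"

definition outs :: "nat \<Rightarrow> vmat \<Rightarrow> nat set" where
  "outs n R = case_prod R ` sq n"

text \<open>The outputs themselves are not counted as cut vertices: they are the sources of edges of the
  enclosing recursion level, and are charged there.\<close>
definition expanding :: "(nat \<times> nat) set \<Rightarrow> nat \<Rightarrow> nat set \<Rightarrow> vmat \<Rightarrow> bool" where
  "expanding E n V R \<longleftrightarrow> outs n R \<subseteq> V \<and> inj_on (case_prod R) (sq n) \<and>
     (\<forall>W. min (card (outs n R \<inter> W)) (card (outs n R - W)) \<le> 4 * card (cut E W (V - outs n R)))"

text \<open>The minimum in \<open>expanding\<close> gives nothing for a family of products if
  \<open>W\<close> contains all outputs of some and none of the others. With \<open>q\<close> at
  most half the outputs of one product, the bound on \<open>U \<inter> W\<close> excludes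
  this.\<close>

definition small_set_expanding :: "(nat \<times> nat) set \<Rightarrow> nat set \<Rightarrow> nat set \<Rightarrow> nat \<Rightarrow> bool" where
  "small_set_expanding E V U q \<longleftrightarrow> U \<subseteq> V \<and>
     (\<forall>W. card (U \<inter> W) \<le> q \<longrightarrow> card (U \<inter> W) \<le> 4 * card (cut E W V))"

lemma finite_sq [simp]: "finite (sq n)"
  by (simp add: sq_def)

lemma card_sq [simp]: "card (sq n) = n * n"
  by (simp add: sq_def card_cartesian_product)

lemma finite_outs [simp]: "finite (outs n R)"
  by (simp add: outs_def)

lemma outsI: "i < n \<Longrightarrow> j < n \<Longrightarrow> R i j \<in> outs n R"
  by (force simp: outs_def sq_def)

lemma edges_of_mono: "set xs \<subseteq> set ys \<Longrightarrow> edges_of xs \<subseteq> edges_of ys"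
  by (auto simp: edges_of_def)

lemma finite_cut: "finite V \<Longrightarrow> finite (cut E W V)"
  by (simp add: cut_def)

lemma cut_subset: "cut E W V \<subseteq> V"
  by (auto simp: cut_def)

lemma cut_mono: "E \<subseteq> E' \<Longrightarrow> V \<subseteq> V' \<Longrightarrow> cut E W V \<subseteq> cut E' W V'"
  by (auto simp: cut_def)

section \<open>Monotonicity and disjoint unions\<close>

lemma expanding_mono:
  assumes "expanding E n V R" "E \<subseteq> E'" "V \<subseteq> V'" "finite V'"
  shows "expanding E' n V' R"
proof -
  have "card (cut E W (V - outs n R)) \<le> card (cut E' W (V' - outs n R))" for W
    using assms by (intro card_mono finite_cut cut_mono) auto
  then show ?thesis
    using assms unfolding expanding_def
    by (meson le_trans mult_le_mono2 subset_trans)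
qed

lemma small_set_expanding_mono:
  assumes "small_set_expanding E V U q" "E \<subseteq> E'" "V \<subseteq> V'" "finite V'"
  shows "small_set_expanding E' V' U q"
proof -
  have "card (cut E W V) \<le> card (cut E' W V')" for W
    using assms by (intro card_mono finite_cut cut_mono) auto
  then show ?thesis
    using assms unfolding small_set_expanding_def
    by (meson le_trans mult_le_mono2 subset_trans)
qed

text \<open>A set \<open>W\<close> with at most \<open>q\<close> of the \<open>n * n\<close> outputs
  has at most half of them, so the minimum in \<open>expanding\<close> is attained on the side of
  \<open>W\<close>.\<close>

lemma expanding_imp_small_set_expanding:
  assumes "expanding E n V R" "finite V" "2 * q \<le> n * n"
  shows "small_set_expanding E V (outs n R) q"
proof -
  have "card (outs n R \<inter> W) \<le> 4 * card (cut E W V)" if "card (outs n R \<inter> W) \<le> q" for W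
  proof -
    have "card (outs n R) = n * n"
      using assms(1) by (simp add: expanding_def outs_def card_image)
    moreover have "card (outs n R) = card (outs n R \<inter> W) + card (outs n R - W)"
      by (metis card_Int_Diff finite_outs)
    ultimately have "card (outs n R \<inter> W) \<le> card (outs n R - W)"
      using that assms(3) by linarith
    then have "card (outs n R \<inter> W) \<le> 4 * card (cut E W (V - outs n R))"
      using assms(1) unfolding expanding_def by (metis min.absorb1)
    also have "\<dots> \<le> 4 * card (cut E W V)"
      using assms(2) by (intro mult_le_mono2 card_mono finite_cut cut_mono) auto
    finally show ?thesis .
  qed
  then show ?thesis
    using assms(1) by (simp add: small_set_expanding_def expanding_def)
qed

text \<open>The bound \<open>q\<close> for the union bounds each \<open>U i \<inter> W\<close> as
  well, and the cuts add up because the \<open>V i\<close> are disjoint.\<close>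

lemma small_set_expanding_UN:
  assumes "finite I" "\<And>i j. i \<in> I \<Longrightarrow> j \<in> I \<Longrightarrow> i \<noteq> j \<Longrightarrow> V i \<inter> V j = {}" "\<And>i. i \<in> I \<Longrightarrow> finite (V i)"
    and sse: "\<And>i. i \<in> I \<Longrightarrow> small_set_expanding E (V i) (U i) q"
  shows "small_set_expanding E (\<Union>i\<in>I. V i) (\<Union>i\<in>I. U i) q"
proof -
  have UV: "U i \<subseteq> V i" if "i \<in> I" for i
    using sse[OF that] by (simp add: small_set_expanding_def)
  have fU: "finite (\<Union>i\<in>I. U i)"
    using assms UV by (meson finite_UN_I finite_subset)
  have "card ((\<Union>i\<in>I. U i) \<inter> W) \<le> 4 * card (cut E W (\<Union>i\<in>I. V i))"
    if q: "card ((\<Union>i\<in>I. U i) \<inter> W) \<le> q" for W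
  proof -
    have piece: "card (U i \<inter> W) \<le> 4 * card (cut E W (V i))" if "i \<in> I" for i
    proof -
      have "card (U i \<inter> W) \<le> card ((\<Union>i\<in>I. U i) \<inter> W)"
        using that fU by (intro card_mono) auto
      then show ?thesis
        using sse[OF that] q by (auto simp: small_set_expanding_def)
    qed
    have "card ((\<Union>i\<in>I. U i) \<inter> W) = card (\<Union>i\<in>I. U i \<inter> W)"
      by (rule arg_cong[where f = card]) auto
    also have "\<dots> \<le> (\<Sum>i\<in>I. card (U i \<inter> W))"
      using assms(1) by (rule card_UN_le)
    also have "\<dots> \<le> (\<Sum>i\<in>I. 4 * card (cut E W (V i)))"
      by (intro sum_mono piece)
    also have "\<dots> = 4 * (\<Sum>i\<in>I. card (cut E W (V i)))"
      by (simp add: sum_distrib_left)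
    also have "(\<Sum>i\<in>I. card (cut E W (V i))) = card (\<Union>i\<in>I. cut E W (V i))"
    proof (rule card_UN_disjoint[symmetric])
      show "\<forall>i\<in>I. \<forall>j\<in>I. i \<noteq> j \<longrightarrow> cut E W (V i) \<inter> cut E W (V j) = {}"
        using assms(2) unfolding cut_def by fast
    qed (use assms finite_cut in auto)
    also have "(\<Union>i\<in>I. cut E W (V i)) = cut E W (\<Union>i\<in>I. V i)"
      by (auto simp: cut_def)
    finally show ?thesis .
  qed
  moreover have "(\<Union>i\<in>I. U i) \<subseteq> (\<Union>i\<in>I. V i)"
    using UV by blast
  ultimately show ?thesis
    by (simp add: small_set_expanding_def)
qed

section \<open>Consecutive vertex intervals\<close>

lemma mono_upto:
  fixes \<tau> :: "nat \<Rightarrow> nat"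
  assumes "\<And>m. m < K \<Longrightarrow> \<tau> m \<le> \<tau> (Suc m)" "m \<le> m'" "m' \<le> K"
  shows "\<tau> m \<le> \<tau> m'"
  using assms(2,3)
proof (induction m' rule: dec_induct)
  case (step n)
  then show ?case using assms(1)[of n] by simp
qed simp

lemma interval_index_unique:
  fixes \<tau> :: "nat \<Rightarrow> nat"
  assumes mono: "\<And>m. m < K \<Longrightarrow> \<tau> m \<le> \<tau> (Suc m)"
    and "m < K" "m' < K" "x \<in> {\<tau> m..<\<tau> (Suc m)}" "x \<in> {\<tau> m'..<\<tau> (Suc m')}"
  shows "m = m'"
proof (rule ccontr)
  assume "m \<noteq> m'"
  then consider "Suc m \<le> m'" | "Suc m' \<le> m" by linarith
  then show False
  proof cases
    case 1
    then have "\<tau> (Suc m) \<le> \<tau> m'"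
      using mono_upto[of K \<tau> "Suc m" m'] mono assms(3) by simp
    then show False using assms(4,5) by simp
  next
    case 2
    then have "\<tau> (Suc m') \<le> \<tau> m"
      using mono_upto[of K \<tau> "Suc m'" m] mono assms(2) by simp
    then show False using assms(4,5) by simp
  qed
qed

section \<open>Assembling a matrix from four blocks\<close>

lemma outs_comb_subset:
  "outs (2 * h) (comb h C1 C2 C3 C4) \<subseteq> outs h C1 \<union> outs h C2 \<union> outs h C3 \<union> outs h C4"
proof
  fix x assume "x \<in> outs (2 * h) (comb h C1 C2 C3 C4)"
  then obtain i j where ij: "i < 2 * h" "j < 2 * h" "x = comb h C1 C2 C3 C4 i j"
    by (auto simp: outs_def sq_def)
  have "i - h < h" "j - h < h" using ij by auto
  then show "x \<in> outs h C1 \<union> outs h C2 \<union> outs h C3 \<union> outs h C4"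
    using ij(3) by (auto simp: comb_def outsI split: if_splits)
qed

lemma inj_on_comb:
  assumes inj: "\<And>C. C \<in> {C1, C2, C3, C4} \<Longrightarrow> inj_on (case_prod C) (sq h)"
    and disj: "outs h C1 \<inter> outs h C2 = {}" "outs h C1 \<inter> outs h C3 = {}" "outs h C1 \<inter> outs h C4 = {}"
      "outs h C2 \<inter> outs h C3 = {}" "outs h C2 \<inter> outs h C4 = {}" "outs h C3 \<inter> outs h C4 = {}"
  shows "inj_on (case_prod (comb h C1 C2 C3 C4)) (sq (2 * h))"
proof -
  have I: "C i j = C i' j' \<longleftrightarrow> i = i' \<and> j = j'"
    if "C \<in> {C1, C2, C3, C4}" "i < h" "j < h" "i' < h" "j' < h" for C i j i' j'
    using inj_onD[OF inj[OF that(1)], of "(i, j)" "(i', j')"] that by (auto simp: sq_def)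
  have D: "C i j \<noteq> C' i' j'"
    if "outs h C \<inter> outs h C' = {}" "i < h" "j < h" "i' < h" "j' < h" for C C' i j i' j'
    using that outsI[of i h j C] outsI[of i' h j' C'] by auto
  note Ds = disj[THEN D]
  show ?thesis
  proof (rule inj_onI, clarify)
    fix i j i' j'
    assume A: "(i, j) \<in> sq (2 * h)" "(i', j') \<in> sq (2 * h)"
      "comb h C1 C2 C3 C4 i j = comb h C1 C2 C3 C4 i' j'"
    then have b: "\<not> i < h \<longrightarrow> i - h < h" "\<not> j < h \<longrightarrow> j - h < h"
      "\<not> i' < h \<longrightarrow> i' - h < h" "\<not> j' < h \<longrightarrow> j' - h < h"
      by (auto simp: sq_def)
    \<comment> \<open>Equal vertices belong to the same quadrant, since different blocks share no
      vertex; what remains is the injectivity of one block.\<close>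
    have eq: "(i < h) = (i' < h) \<and> (j < h) = (j' < h)"
      using A(3) b by (auto simp: comb_def Ds Ds[symmetric] split: if_splits)
    then show "i = i' \<and> j = j'"
      using A(3) b by (cases "i < h"; cases "j < h") (auto simp: comb_def I not_less)
  qed
qed

text \<open>The vertices are numbered in the order of generation: \<open>F 0, \<dots>, F 6\<close> are the block products,
  the later \<open>F m\<close> are the block additions following them, \<open>Q\<close> selects the intermediate sums
  and \<open>o1, \<dots>, o4\<close> the output blocks. The block additions that form the operands of a product fall
  into the slack of the intervals.\<close>
lemma expanding_comb:
  assumes mono: "\<And>m. m < K \<Longrightarrow> \<tau> m \<le> \<tau> (Suc m)"
    and K: "7 \<le> K"
    and rec: "\<And>l. l < 7 \<Longrightarrow> expanding E h {\<tau> l..<\<tau> (Suc l)} (F l)"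
    and pieces: "\<And>m. 7 \<le> m \<Longrightarrow> m < K \<Longrightarrow>
      outs h (F m) \<subseteq> {\<tau> m..<\<tau> (Suc m)} \<and> inj_on (case_prod (F m)) (sq h)"
    and Q: "Q \<subseteq> {7..<K}"
    and o: "distinct [o1, o2, o3, o4]" "{o1, o2, o3, o4} \<subseteq> {7..<K} - Q"
    and conn: "\<And>i j W. i < h \<Longrightarrow> j < h \<Longrightarrow>
      \<forall>q \<in> {..<7} \<union> Q. \<forall>v. (F q i j, v) \<in> E \<longrightarrow> (F q i j \<in> W) = (v \<in> W) \<Longrightarrow>
      \<forall>l < 7. \<forall>b \<in> {o1, o2, o3, o4}. (F b i j \<in> W) = (F l i j \<in> W)"
  shows "expanding E (2 * h) {\<tau> 0..<\<tau> K} (comb h (F o1) (F o2) (F o3) (F o4))"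
proof -
  define R where "R = comb h (F o1) (F o2) (F o3) (F o4)"
  define V where "V = {\<tau> 0..<\<tau> K}"
  have P: "outs h (F m) \<subseteq> {\<tau> m..<\<tau> (Suc m)}" "inj_on (case_prod (F m)) (sq h)" if "m < K" for m
    using rec[of m] pieces[of m] that unfolding expanding_def by (meson not_less)+
  have iV: "{\<tau> m..<\<tau> (Suc m)} \<subseteq> V" if "m < K" for m
  proof -
    have "\<tau> 0 \<le> \<tau> m" "\<tau> (Suc m) \<le> \<tau> K"
      using that by (auto intro!: mono_upto[of K \<tau>] mono)
    then show ?thesis by (auto simp: V_def)
  qed
  have uniq: "m = m'" if "m < K" "m' < K" "x \<in> {\<tau> m..<\<tau> (Suc m)}" "x \<in> {\<tau> m'..<\<tau> (Suc m')}" for m m' x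
    using interval_index_unique[of K \<tau>, OF mono] that by blast
  have oK: "o1 < K" "o2 < K" "o3 < K" "o4 < K"
    using o by auto
  have RS: "outs (2 * h) R \<subseteq> outs h (F o1) \<union> outs h (F o2) \<union> outs h (F o3) \<union> outs h (F o4)"
    unfolding R_def by (rule outs_comb_subset)
  have disj: "outs h (F m) \<inter> outs h (F m') = {}" if "m < K" "m' < K" "m \<noteq> m'" for m m'
    using uniq[OF that(1,2)] P(1)[OF that(1)] P(1)[OF that(2)] that(3) by blast
  have inj: "inj_on (case_prod R) (sq (2 * h))"
    unfolding R_def using o oK by (intro inj_on_comb disj) (auto intro: P)
  have RV: "outs (2 * h) R \<subseteq> V"
    using RS P(1) iV oK by blast
  have "min (card (outs (2 * h) R \<inter> W)) (card (outs (2 * h) R - W))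
      \<le> 4 * card (cut E W (V - outs (2 * h) R))" for W
  proof -
    let ?w = "card (outs (2 * h) R \<inter> W)" and ?w' = "card (outs (2 * h) R - W)"
    \<comment> \<open>These are the positions of the split gadgets: \<open>W\<close> separates an
      output entry from a product entry at the same position.\<close>
    define bad where "bad = {(i, j) \<in> sq h. \<exists>l<7. \<exists>b\<in>{o1, o2, o3, o4}. (F b i j \<in> W) \<noteq> (F l i j \<in> W)}"
    have bsq: "bad \<subseteq> sq h" by (auto simp: bad_def)
    then have fbad: "finite bad" by (rule finite_subset) simp
    \<comment> \<open>This is \<open>conn\<close> read backwards: if no product entry or
      intermediate sum at this position were the source of an edge across \<open>W\<close>, all
      product and output entries there would lie on one side.\<close>
    have src: "\<exists>q\<in>{..<7} \<union> Q. case_prod (F q) p \<in> cut E W V" if "p \<in> bad" for p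
    proof -
      obtain i j where p: "p = (i, j)" by force
      have ij: "i < h" "j < h" using that bsq p by (auto simp: sq_def)
      have "\<not> (\<forall>l < 7. \<forall>b \<in> {o1, o2, o3, o4}. (F b i j \<in> W) = (F l i j \<in> W))"
        using that p by (auto simp: bad_def)
      then obtain q v where q: "q \<in> {..<7} \<union> Q" "(F q i j, v) \<in> E" "(F q i j \<in> W) \<noteq> (v \<in> W)"
        using conn[OF ij] by blast
      then have "F q i j \<in> V"
        using P(1)[of q] iV[of q] outsI[OF ij, of "F q"] K Q by force
      then show ?thesis
        using q p by (auto simp: cut_def)
    qed
    then obtain q where q: "\<And>p. p \<in> bad \<Longrightarrow> q p \<in> {..<7} \<union> Q \<and> case_prod (F (q p)) p \<in> cut E W V"
      by metis
    define g where "g p = case_prod (F (q p)) p" for p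
    have qK: "q p < K" if "p \<in> bad" for p
      using q[OF that] K Q by auto
    have gouts: "g p \<in> outs h (F (q p))" if "p \<in> bad" for p
      using that bsq by (auto simp: g_def outs_def)
    have gI: "g p \<in> {\<tau> (q p)..<\<tau> (Suc (q p))}" if "p \<in> bad" for p
      using gouts[OF that] P(1)[OF qK[OF that]] by blast
    \<comment> \<open>The interval containing \<open>g p\<close> determines the block
      \<open>q p\<close>, and the entries within a block are distinct.\<close>
    have ginj: "inj_on g bad"
    proof (rule inj_onI)
      fix p p' assume A: "p \<in> bad" "p' \<in> bad" "g p = g p'"
      then have e: "q p = q p'" using uniq qK gI by metis
      show "p = p'"
        using inj_onD[OF P(2)[OF qK[OF A(1)]], of p p'] A bsq by (auto simp: g_def e)
    qed
    \<comment> \<open>The cuts inside the products leave out the outputs of the products. These are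
      left to be charged by \<open>g\<close>, so that no vertex is counted twice.\<close>
    let ?T = "\<lambda>l. cut E W ({\<tau> l..<\<tau> (Suc l)} - outs h (F l))"
    let ?T' = "\<Union>l\<in>{..<7}. ?T l"
    have cardT: "card ?T' = (\<Sum>l\<in>{..<7}. card (?T l))"
    proof (rule card_UN_disjoint)
      show "\<forall>l\<in>{..<7}. \<forall>l'\<in>{..<7}. l \<noteq> l' \<longrightarrow> ?T l \<inter> ?T l' = {}"
      proof (intro ballI impI)
        fix l l' :: nat assume "l \<in> {..<7}" "l' \<in> {..<7}" "l \<noteq> l'"
        then have "{\<tau> l..<\<tau> (Suc l)} \<inter> {\<tau> l'..<\<tau> (Suc l')} = {}"
          using uniq[of l l'] K by fastforce
        then show "?T l \<inter> ?T l' = {}"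
          using cut_subset by fast
      qed
    qed (auto intro: finite_cut)
    have gdisj: "g ` bad \<inter> ?T' = {}"
    proof -
      have False if "p \<in> bad" "l < 7" "g p \<in> {\<tau> l..<\<tau> (Suc l)} - outs h (F l)" for p l
      proof -
        have "q p = l" using uniq[OF qK[OF that(1)], of l] gI[OF that(1)] that K by auto
        then show False using gouts[OF that(1)] that(3) by auto
      qed
      then show ?thesis using cut_subset by (fastforce dest: subsetD)
    qed
    \<comment> \<open>All counted vertices lie in intervals with index in
      \<open>{..<7} \<union> Q\<close>, whereas the outputs of \<open>R\<close> lie in the intervals
      \<open>o1\<close> to \<open>o4\<close>.\<close>
    have sub: "g ` bad \<union> ?T' \<subseteq> cut E W (V - outs (2 * h) R)"
    proof -
      have "x \<notin> outs (2 * h) R" if "x \<in> {\<tau> m..<\<tau> (Suc m)}" "m < K" "m \<notin> {o1, o2, o3, o4}" for x m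
      proof
        assume "x \<in> outs (2 * h) R"
        then obtain b where b: "b \<in> {o1, o2, o3, o4}" "x \<in> outs h (F b)"
          using RS by blast
        then have "b < K" using oK by auto
        then have "m = b" using uniq[OF that(2) _ that(1)] P(1) b(2) by blast
        then show False using b(1) that(3) by blast
      qed
      moreover have "m < K \<and> m \<notin> {o1, o2, o3, o4}" if "m \<in> {..<7} \<union> Q" for m
        using that K Q o(2) by auto
      ultimately have nR: "x \<notin> outs (2 * h) R" if "x \<in> {\<tau> m..<\<tau> (Suc m)}" "m \<in> {..<7} \<union> Q" for x m
        using that by blast
      have "g p \<in> cut E W (V - outs (2 * h) R)" if "p \<in> bad" for p
        using nR[OF gI[OF that]] q[OF that] by (auto simp: cut_def g_def)
      moreover have "?T l \<subseteq> cut E W (V - outs (2 * h) R)" if "l < 7" for l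
        using nR[of _ l] that iV[of l] K by (intro cut_mono) auto
      ultimately show ?thesis by blast
    qed
    have "card bad + (\<Sum>l\<in>{..<7}. card (?T l)) = card (g ` bad) + card ?T'"
      using ginj by (simp add: card_image cardT)
    also have "\<dots> = card (g ` bad \<union> ?T')"
      using gdisj fbad by (intro card_Un_disjoint[symmetric]) (auto intro: finite_cut)
    also have "\<dots> \<le> card (cut E W (V - outs (2 * h) R))"
      using sub by (intro card_mono finite_cut) (auto simp: V_def)
    finally have total: "card bad + (\<Sum>l\<in>{..<7}. card (?T l)) \<le> card (cut E W (V - outs (2 * h) R))" .

    \<comment> \<open>Away from \<open>bad\<close>, the entries of \<open>F b\<close> and
      \<open>F l\<close> at the same position lie on the same side of \<open>W\<close>. Admitting
      both \<open>W\<close> and its complement for \<open>X\<close> serves both terms of the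
      minimum.\<close>
    have blockwise: "card (outs h (F b) \<inter> X) \<le> card (outs h (F l) \<inter> X) + card bad"
      if "b \<in> {o1, o2, o3, o4}" "l < 7" "X = W \<or> X = - W" for b l X
    proof -
      have "card (outs h (F b) \<inter> X) \<le> card {p \<in> sq h. case_prod (F b) p \<in> X}"
        unfolding outs_def
        by (rule order_trans[OF _ card_image_le[where f = "case_prod (F b)"]]) (auto intro: card_mono)
      also have "\<dots> \<le> card ({p \<in> sq h. case_prod (F l) p \<in> X} \<union> bad)"
        using that fbad by (intro card_mono) (auto simp: bad_def)
      also have "\<dots> \<le> card {p \<in> sq h. case_prod (F l) p \<in> X} + card bad"
        by (rule card_Un_le)
      also have "card {p \<in> sq h. case_prod (F l) p \<in> X} = card (case_prod (F l) ` {p \<in> sq h. case_prod (F l) p \<in> X})"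
        using P(2)[of l] that K by (intro card_image[symmetric]) (auto intro: inj_on_subset)
      also have "case_prod (F l) ` {p \<in> sq h. case_prod (F l) p \<in> X} = outs h (F l) \<inter> X"
        by (auto simp: outs_def)
      finally show ?thesis .
    qed
    have side: "card (outs (2 * h) R \<inter> X) \<le> 4 * card (outs h (F l) \<inter> X) + 4 * card bad"
      if "l < 7" "X = W \<or> X = - W" for l X
    proof -
      have "card (outs (2 * h) R \<inter> X) \<le> card ((outs h (F o1) \<inter> X) \<union> (outs h (F o2) \<inter> X)
          \<union> (outs h (F o3) \<inter> X) \<union> (outs h (F o4) \<inter> X))"
        using RS by (intro card_mono) auto
      also have "\<dots> \<le> card (outs h (F o1) \<inter> X) + card (outs h (F o2) \<inter> X)
          + card (outs h (F o3) \<inter> X) + card (outs h (F o4) \<inter> X)"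
        by (meson add_mono card_Un_le le_refl order_trans)
      finally show ?thesis
        using blockwise[of o1 l X] blockwise[of o2 l X] blockwise[of o3 l X] blockwise[of o4 l X] that
        by simp
    qed
    have "min ?w ?w' \<le> 16 * card (?T l) + 4 * card bad" if "l < 7" for l
    proof -
      have "min (card (outs h (F l) \<inter> W)) (card (outs h (F l) - W)) \<le> 4 * card (?T l)"
        using rec[OF that] by (simp add: expanding_def)
      then show ?thesis
        using side[OF that, of W] side[OF that, of "- W"] by (simp add: Diff_eq min_def split: if_splits)
    qed
    \<comment> \<open>Summation over the seven products reproduces the constant 4: the right-hand
      side is at most \<open>28 = 7 * 4\<close> times the total cut. The coefficient 28 of
      \<open>card bad\<close> is tight for this, while the cuts inside the products only need
      16.\<close>
    then have "(\<Sum>l\<in>{..<7::nat}. min ?w ?w') \<le> (\<Sum>l\<in>{..<7}. 16 * card (?T l) + 4 * card bad)"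
      by (intro sum_mono) simp
    then have "7 * min ?w ?w' \<le> 16 * (\<Sum>l\<in>{..<7}. card (?T l)) + 28 * card bad"
      by (simp add: sum.distrib sum_distrib_left)
    then show ?thesis using total by linarith
  qed
  then show ?thesis
    using RV inj by (simp add: expanding_def R_def V_def)
qed

section \<open>Segments of a schedule\<close>

lemma run_append:
  "run G M (xs @ ys) st = (case run G M xs st of None \<Rightarrow> None | Some st' \<Rightarrow> run G M ys st')"
  by (induction xs arbitrary: st) (auto split: option.splits)

lemma io_cost_append: "io_cost (xs @ ys) = io_cost xs + io_cost ys"
  by (simp add: io_cost_def)

definition io_words :: "action list \<Rightarrow> nat set" where
  "io_words sch = {x. Read x \<in> set sch \<or> Write x \<in> set sch}"

lemma io_words_append: "io_words (xs @ ys) = io_words xs \<union> io_words ys"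
  by (auto simp: io_words_def)

lemma io_words_bound: "finite (io_words sch) \<and> card (io_words sch) \<le> io_cost sch"
proof (induction sch)
  case (Cons a sch)
  show ?case
  proof (cases a)
    case (Read x)
    then have "io_words (a # sch) = insert x (io_words sch)" by (auto simp: io_words_def)
    then show ?thesis
      using Cons Read by (simp add: io_cost_def card_insert_if le_SucI)
  next
    case (Write x)
    then have "io_words (a # sch) = insert x (io_words sch)" by (auto simp: io_words_def)
    then show ?thesis
      using Cons Write by (simp add: io_cost_def card_insert_if le_SucI)
  next
    case (Compute x)
    then have "io_words (a # sch) = io_words sch" by (auto simp: io_words_def)
    then show ?thesis using Cons Compute by (simp add: io_cost_def)
  next
    case (Discard x)
    then have "io_words (a # sch) = io_words sch" by (auto simp: io_words_def)
    then show ?thesis using Cons Discard by (simp add: io_cost_def)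
  qed
qed (simp add: io_words_def io_cost_def)

section \<open>Invariants of the memory contents\<close>

locale cdag_schedule =
  fixes G :: cdag and M :: nat
  assumes distinct_ops: "distinct (map fst (fst (snd G)))"
begin

abbreviation "E \<equiv> edges_of (fst (snd G))"

text \<open>\<open>Compute\<close> asks for some recorded operation with its operands in fast
  memory. As a vertex heads only one operation, all its predecessors must then be there.\<close>

lemma op_operands:
  assumes "(v, u, w) \<in> set (fst (snd G))" "(a, v) \<in> E"
  shows "a = u \<or> a = w"
  using assms distinct_ops by (fastforce simp: edges_of_def dest: eq_key_imp_eq_value)

text \<open>The inputs count as computed from the start, so \<open>D\<close> contains every value
  available so far. Closure under operands shows that a vertex with an operand outside
  \<open>D\<close> is itself outside \<open>D\<close>.\<close>

definition consistent :: "mstate \<Rightarrow> bool" where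
  "consistent st = (case st of (F, S, D) \<Rightarrow>
     finite F \<and> card F \<le> M \<and> F \<union> S \<subseteq> D \<and> (\<forall>(a, v) \<in> E. v \<in> D \<longrightarrow> a \<in> D))"

lemma step_facts:
  assumes "step G M x (F, S, D) = Some (F', S', D')" "consistent (F, S, D)"
  shows "consistent (F', S', D')" "D \<subseteq> D'" "\<exists>y. D' \<subseteq> insert y D"
    "F' \<subseteq> F \<union> io_words [x] \<union> (D' - D)" "F' \<union> S' \<subseteq> F \<union> S \<union> (D' - D)" "S' \<subseteq> S \<union> io_words [x]"
    "\<And>a v. (a, v) \<in> E \<Longrightarrow> v \<in> D' - D \<Longrightarrow> a \<in> F"
proof -
  have "consistent (F', S', D') \<and> D \<subseteq> D' \<and> (\<exists>y. D' \<subseteq> insert y D) \<and>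
    F' \<subseteq> F \<union> io_words [x] \<union> (D' - D) \<and> F' \<union> S' \<subseteq> F \<union> S \<union> (D' - D) \<and> S' \<subseteq> S \<union> io_words [x] \<and>
    (\<forall>a v. (a, v) \<in> E \<longrightarrow> v \<in> D' - D \<longrightarrow> a \<in> F)"
  proof (cases x)
    case (Read y)
    then show ?thesis using assms
      by (auto simp: consistent_def io_words_def split: if_splits)
  next
    case (Write y)
    then show ?thesis using assms
      by (auto simp: consistent_def io_words_def split: if_splits)
  next
    case (Discard y)
    then have "F' = F - {y}" "S' = S" "D' = D" using assms(1) by auto
    moreover have "card (F - {y}) \<le> card F" if "finite F" using that by (intro card_mono) auto
    ultimately show ?thesis using assms(2)
      by (force simp: consistent_def io_words_def)
  next
    case (Compute y)
    then obtain u w where c: "y \<notin> D" "(y, u, w) \<in> set (fst (snd G))" "u \<in> F" "w \<in> F"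
      "card (insert y F) \<le> M" "F' = insert y F" "S' = S" "D' = insert y D"
      using assms(1) by (auto split: if_splits)
    have opF: "a \<in> F" if "(a, y) \<in> E" for a
      using op_operands[OF c(2) that] c by auto
    have "F \<subseteq> D" using assms(2) by (auto simp: consistent_def)
    then show ?thesis
      using c assms(2) opF by (fastforce simp: consistent_def)
  qed
  then show "consistent (F', S', D')" "D \<subseteq> D'" "\<exists>y. D' \<subseteq> insert y D"
    "F' \<subseteq> F \<union> io_words [x] \<union> (D' - D)" "F' \<union> S' \<subseteq> F \<union> S \<union> (D' - D)" "S' \<subseteq> S \<union> io_words [x]"
    "\<And>a v. (a, v) \<in> E \<Longrightarrow> v \<in> D' - D \<Longrightarrow> a \<in> F"
    by blast+
qed

text \<open>The first containment for an operand \<open>a\<close> limits what a segment takes from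
  outside to its initial fast memory and its traffic. The second is applied to the rest of the
  schedule: a value computed before and used later is still stored when the segment ends.\<close>

lemma run_facts:
  assumes "run G M sch (F, S, D) = Some (F', S', D')" "consistent (F, S, D)"
  shows "consistent (F', S', D') \<and> D \<subseteq> D' \<and> S' \<subseteq> S \<union> io_words sch \<and>
    (\<forall>a v. (a, v) \<in> E \<longrightarrow> v \<in> D' - D \<longrightarrow>
      a \<in> F \<union> io_words sch \<union> (D' - D) \<and> a \<in> F \<union> S \<union> (D' - D))"
  using assms
proof (induction sch arbitrary: F S D)
  case (Cons x sch)
  then obtain F1 S1 D1 where st: "step G M x (F, S, D) = Some (F1, S1, D1)"
    "run G M sch (F1, S1, D1) = Some (F', S', D')"
    by (auto split: option.splits)
  note s = step_facts[OF st(1) Cons.prems(2)]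
  note r = Cons.IH[OF st(2) s(1)]
  have io: "io_words (x # sch) = io_words [x] \<union> io_words sch"
    using io_words_append[of "[x]" sch] by simp
  have "a \<in> F \<union> io_words (x # sch) \<union> (D' - D) \<and> a \<in> F \<union> S \<union> (D' - D)"
    if "(a, v) \<in> E" "v \<in> D' - D" for a v
  proof (cases "v \<in> D1")
    case True
    then show ?thesis using s(7)[OF that(1)] that by blast
  next
    case False
    then have "a \<in> F1 \<union> io_words sch \<union> (D' - D1)" "a \<in> F1 \<union> S1 \<union> (D' - D1)"
      using r that by blast+
    then show ?thesis using s(2,4,5) r unfolding io by blast
  qed
  moreover have "S' \<subseteq> S \<union> io_words (x # sch)" using s(6) r unfolding io by blast
  ultimately show ?case using r s(2) by blast
qed auto

text \<open>Take \<open>W = D' - D\<close>. The source of an edge entering \<open>W\<close> was in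
  \<open>F\<close> or was moved. An edge leaving \<open>W\<close> ends in a vertex computed by
  \<open>rest\<close>, so its source is in \<open>F' \<union> S'\<close>; being new, it can be in
  slow memory only if it was moved during the segment. The contents \<open>F\<close> and
  \<open>F'\<close> account for \<open>2 * M\<close>.\<close>

lemma segment_io:
  assumes "run G M seg (F, S, D) = Some (F', S', D')" "consistent (F, S, D)"
    and "run G M rest (F', S', D') = Some (F'', S'', D'')"
    and all: "\<And>a v. (a, v) \<in> E \<Longrightarrow> v \<in> D''"
  shows "card (cut E (D' - D) V) \<le> 2 * M + io_cost seg"
proof -
  note r1 = run_facts[OF assms(1,2)]
  have c: "consistent (F', S', D')" using r1 by simp
  note r2 = run_facts[OF assms(3) c]
  have sub: "cut E (D' - D) V \<subseteq> F \<union> F' \<union> io_words seg"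
  proof
    fix a assume "a \<in> cut E (D' - D) V"
    then obtain v where v: "(a, v) \<in> E" "(a \<in> D' - D) \<noteq> (v \<in> D' - D)"
      by (auto simp: cut_def)
    show "a \<in> F \<union> F' \<union> io_words seg"
    proof (cases "v \<in> D' - D")
      case True
      then show ?thesis using r1 v by blast
    next
      case False
      then have a: "a \<in> D'" "a \<notin> D" using v by auto
      \<comment> \<open>\<open>D\<close> is closed under operands and lacks \<open>a\<close>. Hence
        \<open>v\<close>, which is computed eventually, is computed after the segment.\<close>
      then have "v \<notin> D" using assms(2) v(1) by (auto simp: consistent_def)
      then have "v \<in> D'' - D'" using False all[OF v(1)] by blast
      then have "a \<in> F' \<union> S'" using r2 v(1) a by blast
      moreover have "a \<notin> S" using a assms(2) by (auto simp: consistent_def)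
      ultimately show ?thesis using r1 by blast
    qed
  qed
  have fin: "finite F" "finite F'" "card F \<le> M" "card F' \<le> M"
    using assms(2) c by (auto simp: consistent_def)
  have "card (cut E (D' - D) V) \<le> card (F \<union> F' \<union> io_words seg)"
    using fin io_words_bound sub by (intro card_mono) auto
  also have "\<dots> \<le> card F + card F' + card (io_words seg)"
    by (meson add_mono card_Un_le le_refl order_trans)
  finally show ?thesis
    using fin io_words_bound[of seg] by linarith
qed

text \<open>An action computes at most one vertex, so the count grows by at most one at a time and
  takes every value up to the final one.\<close>

lemma exists_prefix_computing:
  assumes "run G M sch (F, S, D) = Some (F', S', D')" "consistent (F, S, D)"
    and "q \<le> card (U \<inter> (D' - D))" "finite U"
  shows "\<exists>seg rest F1 S1 D1. sch = seg @ rest \<and> run G M seg (F, S, D) = Some (F1, S1, D1) \<and>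
    card (U \<inter> (D1 - D)) = q"
  using assms(1,3)
proof (induction sch arbitrary: F' S' D' rule: rev_induct)
  case Nil
  then show ?case by auto
next
  case (snoc x xs)
  show ?case
  proof (cases "card (U \<inter> (D' - D)) = q")
    case True
    then show ?thesis using snoc.prems(1) by (intro exI[of _ "xs @ [x]"] exI[of _ "[]"]) auto
  next
    case False
    obtain F1 S1 D1 where st: "run G M xs (F, S, D) = Some (F1, S1, D1)"
      "step G M x (F1, S1, D1) = Some (F', S', D')"
      using snoc.prems(1) by (auto simp: run_append split: option.splits)
    have "consistent (F1, S1, D1)" using run_facts[OF st(1) assms(2)] by simp
    then obtain y where "D' \<subseteq> insert y D1" using step_facts(3)[OF st(2)] by blast
    then have "U \<inter> (D' - D) \<subseteq> insert y (U \<inter> (D1 - D))" by blast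
    then have "card (U \<inter> (D' - D)) \<le> card (insert y (U \<inter> (D1 - D)))"
      using assms(4) by (intro card_mono) auto
    also have "\<dots> \<le> Suc (card (U \<inter> (D1 - D)))"
      using assms(4) by (intro card_insert_le_m1) auto
    finally have "q \<le> card (U \<inter> (D1 - D))" using False snoc.prems(2) by linarith
    then obtain seg rest F2 S2 D2 where "xs = seg @ rest" "run G M seg (F, S, D) = Some (F2, S2, D2)"
      "card (U \<inter> (D2 - D)) = q"
      using snoc.IH[OF st(1)] by blast
    then show ?thesis by (intro exI[of _ seg] exI[of _ "rest @ [x]"]) auto
  qed
qed

text \<open>A segment computing exactly \<open>q\<close> vertices of \<open>U\<close> has at least
  \<open>q / 4\<close>, hence at least \<open>3 * M\<close>, cut vertices, and the fast memory at
  its two ends covers at most \<open>2 * M\<close> of them. The induction on \<open>t\<close> cuts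
  off the first segment.\<close>

lemma io_lower_bound:
  assumes "run G M sch (F, S, D) = Some (F', S', D')" "consistent (F, S, D)"
    and all: "\<And>a v. (a, v) \<in> E \<Longrightarrow> v \<in> D'"
    and sse: "small_set_expanding E V U q" "12 * M \<le> q" "finite U"
    and "t * q \<le> card (U \<inter> (D' - D))"
  shows "t * M \<le> io_cost sch"
  using assms(1,2,7)
proof (induction t arbitrary: sch F S D)
  case (Suc t)
  have "q \<le> card (U \<inter> (D' - D))" using Suc.prems(3) by simp
  then obtain seg rest F1 S1 D1 where seg: "sch = seg @ rest" "run G M seg (F, S, D) = Some (F1, S1, D1)"
    "card (U \<inter> (D1 - D)) = q"
    using exists_prefix_computing[OF Suc.prems(1,2) _ sse(3)] by blast
  then have rest: "run G M rest (F1, S1, D1) = Some (F', S', D')"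
    using Suc.prems(1) by (simp add: run_append)
  have c: "consistent (F1, S1, D1)" using run_facts[OF seg(2) Suc.prems(2)] by simp
  have "card (U \<inter> (D' - D)) \<le> card (U \<inter> (D1 - D) \<union> U \<inter> (D' - D1))"
    using sse(3) by (intro card_mono) auto
  also have "\<dots> \<le> q + card (U \<inter> (D' - D1))"
    using card_Un_le seg(3) by metis
  finally have "t * q \<le> card (U \<inter> (D' - D1))" using Suc.prems(3) by simp
  then have IH: "t * M \<le> io_cost rest" using Suc.IH[OF rest c] by simp
  have "q \<le> 4 * card (cut E (D1 - D) V)"
    using sse(1) seg(3) by (metis le_refl small_set_expanding_def)
  moreover have "card (cut E (D1 - D) V) \<le> 2 * M + io_cost seg"
    by (rule segment_io[OF seg(2) Suc.prems(2) rest all])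
  ultimately have "M \<le> io_cost seg" using sse(2) by linarith
  then show ?case using IH by (simp add: seg(1) io_cost_append)
qed simp

end

section \<open>The recursion of the generators\<close>

text \<open>Prescribing the heads exactly gives two things: no vertex heads two new operations, and
  the work of a call is an interval of vertices, disjoint from those of earlier and later
  calls.\<close>

definition extends :: "gst \<Rightarrow> gst \<Rightarrow> bool" where
  "extends st st' \<longleftrightarrow> fst st \<le> fst st' \<and>
     (\<exists>ops. snd st' = ops @ snd st \<and> map fst ops = rev [fst st..<fst st'])"

lemma extends_refl: "extends st st"
  by (simp add: extends_def)

lemma extends_trans:
  assumes "extends st st'" "extends st' st''"
  shows "extends st st''"
proof -
  have "rev [fst st'..<fst st''] @ rev [fst st..<fst st'] = rev [fst st..<fst st'']"
    using assms by (metis extends_def rev_append upt_add_eq_append le_add_diff_inverse)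
  then show ?thesis
    using assms by (fastforce simp: extends_def)
qed

lemma extends_fst: "extends st st' \<Longrightarrow> fst st \<le> fst st'"
  by (simp add: extends_def)

lemma extends_set: "extends st st' \<Longrightarrow> set (snd st) \<subseteq> set (snd st')"
  by (auto simp: extends_def)

lemma binop_extends: "binop u w st = (v, st') \<Longrightarrow> extends st st'"
  by (auto simp: binop_def extends_def)

section \<open>Block additions\<close>

definition madd_step :: "vmat \<Rightarrow> vmat \<Rightarrow> nat \<times> nat \<Rightarrow> vmat \<times> gst \<Rightarrow> vmat \<times> gst" where
  "madd_step X Y = (\<lambda>(i, j) (R, s). case binop (X i j) (Y i j) s of
     (v, s') \<Rightarrow> (R(i := (R i)(j := v)), s'))"

lemma madd_step_Pair:
  "madd_step X Y (i, j) (R, s) =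
     (R(i := (R i)(j := fst s)), Suc (fst s), (fst s, X i j, Y i j) # snd s)"
  by (simp add: madd_step_def binop_def)

text \<open>The entries are distinct because each gets a fresh number, and they survive to the end
  because a list of distinct positions overwrites none of them.\<close>

lemma fold_madd_step:
  assumes "fold (madd_step X Y) xs (R0, st) = (R, st')" "distinct xs"
  shows "extends st st' \<and> case_prod R ` set xs \<subseteq> {fst st..<fst st'} \<and>
    inj_on (case_prod R) (set xs) \<and> (\<forall>(i, j) \<in> set xs. (R i j, X i j, Y i j) \<in> set (snd st'))"
  using assms
proof (induction xs arbitrary: R st' rule: rev_induct)
  case Nil
  then show ?case by (simp add: extends_refl)
next
  case (snoc p xs)
  obtain i j where p: "p = (i, j)" by force
  obtain R1 st1 where 1: "fold (madd_step X Y) xs (R0, st) = (R1, st1)"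
    by (rule that[OF surjective_pairing])
  have IH: "extends st st1" "case_prod R1 ` set xs \<subseteq> {fst st..<fst st1}"
    "inj_on (case_prod R1) (set xs)" "\<forall>(i, j) \<in> set xs. (R1 i j, X i j, Y i j) \<in> set (snd st1)"
    using snoc.IH[OF 1] snoc.prems(2) by auto
  have R: "R = R1(i := (R1 i)(j := fst st1))" "st' = (Suc (fst st1), (fst st1, X i j, Y i j) # snd st1)"
    using snoc.prems(1) by (simp_all add: 1 p madd_step_Pair)
  have new: "(i, j) \<notin> set xs" using snoc.prems(2) p by auto
  have old: "case_prod R q = case_prod R1 q" if "q \<in> set xs" for q
    using new that R by (cases q) auto
  have val: "case_prod R (i, j) = fst st1" using R by simp
  have "extends st1 st'" by (simp add: R extends_def)
  then have "extends st st'" by (rule extends_trans[OF IH(1)])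
  moreover have "case_prod R ` set (xs @ [p]) \<subseteq> {fst st..<fst st'}"
    using IH(1,2) val R(2) by (auto simp: p old image_subset_iff simp del: case_prod_conv dest!: extends_fst)
  moreover have "inj_on (case_prod R) (set (xs @ [p]))"
  proof -
    have "inj_on (case_prod R) (set xs)" using IH(3) old by (metis inj_on_cong)
    moreover have "case_prod R (i, j) \<notin> case_prod R ` set xs"
    proof -
      have "case_prod R ` set xs = case_prod R1 ` set xs" using old by (intro image_cong) auto
      then show ?thesis using IH(2) val by auto
    qed
    ultimately show ?thesis using new by (simp add: p)
  qed
  moreover have "\<forall>(i, j) \<in> set (xs @ [p]). (R i j, X i j, Y i j) \<in> set (snd st')"
    using IH(4) old val by (fastforce simp: p R(2))
  ultimately show ?case by blast
qed

lemma set_idx: "set (idx m) = sq m"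
  by (auto simp: idx_def sq_def)

lemma distinct_idx: "distinct (idx m)"
proof -
  have "idx m = List.product [0..<m] [0..<m]"
    by (simp add: idx_def product_concat_map)
  then show ?thesis by (simp add: distinct_product)
qed

lemma
  assumes "madd m X Y st = (R, st')"
  shows madd_extends: "extends st st'"
    and madd_outs: "outs m R \<subseteq> {fst st..<fst st'} \<and> inj_on (case_prod R) (sq m)"
    and madd_ops: "i < m \<Longrightarrow> j < m \<Longrightarrow> (R i j, X i j, Y i j) \<in> set (snd st')"
  using fold_madd_step[OF assms[unfolded madd_def, folded madd_step_def] distinct_idx]
  by (auto simp: set_idx outs_def sq_def)

lemma madd_edges:
  assumes "madd m X Y st = (R, st')" "extends st' st''" "i < m" "j < m"
  shows "(X i j, R i j) \<in> edges_of (snd st'')" "(Y i j, R i j) \<in> edges_of (snd st'')"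
  using madd_ops[OF assms(1,3,4)] extends_set[OF assms(2)] by (auto simp: edges_of_def)

text \<open>The indices have the same meaning as in \<open>expanding_comb\<close>.\<close>
definition decomposes ::
  "(nat \<Rightarrow> vmat \<Rightarrow> vmat \<Rightarrow> gst \<Rightarrow> vmat \<times> gst) \<Rightarrow> nat \<Rightarrow> gst \<Rightarrow> vmat \<Rightarrow> gst \<Rightarrow> bool" where
  "decomposes alg k st R st' \<longleftrightarrow> (\<exists>\<tau> F K Q o1 o2 o3 o4.
     R = comb (2 ^ k) (F o1) (F o2) (F o3) (F o4) \<and>
     fst st \<le> \<tau> 0 \<and> \<tau> K \<le> fst st' \<and> 7 \<le> K \<and>
     (\<forall>m<K. \<tau> m \<le> \<tau> (Suc m)) \<and>
     (\<forall>l<7. \<exists>A B s s'. alg k A B s = (F l, s') \<and> \<tau> l \<le> fst s \<and> fst s' \<le> \<tau> (Suc l) \<and>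
        set (snd s') \<subseteq> set (snd st')) \<and>
     (\<forall>m<K. 7 \<le> m \<longrightarrow> outs (2 ^ k) (F m) \<subseteq> {\<tau> m..<\<tau> (Suc m)} \<and> inj_on (case_prod (F m)) (sq (2 ^ k))) \<and>
     Q \<subseteq> {7..<K} \<and> distinct [o1, o2, o3, o4] \<and> {o1, o2, o3, o4} \<subseteq> {7..<K} - Q \<and>
     (\<forall>i<2 ^ k. \<forall>j<2 ^ k. \<forall>W.
        (\<forall>q \<in> {..<7} \<union> Q. \<forall>v. (F q i j, v) \<in> edges_of (snd st') \<longrightarrow> (F q i j \<in> W) = (v \<in> W)) \<longrightarrow>
        (\<forall>l<7. \<forall>b \<in> {o1, o2, o3, o4}. (F b i j \<in> W) = (F l i j \<in> W))))"

text \<open>Unrolls bounded quantifiers into conjunctions, so that claims about explicit lists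
  indexed by numerals can be settled by simplification.\<close>

lemma all_less_numeral:
  "(\<forall>m < numeral v. P m) \<longleftrightarrow> (\<forall>m < pred_numeral v. P m) \<and> P (pred_numeral v)"
  "(\<forall>m < Suc 0. P m) \<longleftrightarrow> P 0" "(\<forall>m < (1::nat). P m) \<longleftrightarrow> P 0"
  "(\<forall>m \<in> {..<numeral v}. P m) \<longleftrightarrow> (\<forall>m < numeral v. P m)"
  by (auto simp: numeral_eq_Suc less_Suc_eq)

text \<open>Both algorithms enter the argument only through these properties: seven recursive calls
  on disjoint intervals, tied to the four output blocks by additions. How the operands of the calls
  are formed is left open.\<close>

locale seven_product_scheme =
  fixes alg :: "nat \<Rightarrow> vmat \<Rightarrow> vmat \<Rightarrow> gst \<Rightarrow> vmat \<times> gst"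
  assumes alg_0: "alg 0 A B st = (R, st') \<Longrightarrow> R 0 0 \<in> {fst st..<fst st'}"
    and alg_Suc: "alg (Suc k) A B st = (R, st') \<Longrightarrow> decomposes alg k st R st'"
    and alg_extends: "alg k A B st = (R, st') \<Longrightarrow> extends st st'"
begin

lemma alg_expanding:
  "alg k A B st = (R, st') \<Longrightarrow> expanding (edges_of (snd st')) (2 ^ k) {fst st..<fst st'} R"
proof (induction k arbitrary: A B st R st')
  case 0
  \<comment> \<open>The single output lies on one side of \<open>W\<close>, so the minimum is
    zero.\<close>
  have o: "outs 1 R = {R 0 0}" "inj_on (case_prod R) (sq 1)"
    by (auto simp: outs_def sq_def lessThan_Suc)
  then have "min (card (outs 1 R \<inter> W)) (card (outs 1 R - W)) = 0" for W
    by (cases "R 0 0 \<in> W") auto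
  then show ?case
    using o alg_0[OF 0] by (simp add: expanding_def)
next
  case (Suc k)
  obtain \<tau> F K Q o1 o2 o3 o4 where d:
    "R = comb (2 ^ k) (F o1) (F o2) (F o3) (F o4)"
    "fst st \<le> \<tau> 0" "\<tau> K \<le> fst st'" "7 \<le> K"
    "\<forall>m<K. \<tau> m \<le> \<tau> (Suc m)"
    "\<forall>l<7. \<exists>A B s s'. alg k A B s = (F l, s') \<and> \<tau> l \<le> fst s \<and> fst s' \<le> \<tau> (Suc l) \<and>
        set (snd s') \<subseteq> set (snd st')"
    "\<forall>m<K. 7 \<le> m \<longrightarrow> outs (2 ^ k) (F m) \<subseteq> {\<tau> m..<\<tau> (Suc m)} \<and> inj_on (case_prod (F m)) (sq (2 ^ k))"
    "Q \<subseteq> {7..<K}" "distinct [o1, o2, o3, o4]" "{o1, o2, o3, o4} \<subseteq> {7..<K} - Q"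
    "\<forall>i<2 ^ k. \<forall>j<2 ^ k. \<forall>W.
        (\<forall>q \<in> {..<7} \<union> Q. \<forall>v. (F q i j, v) \<in> edges_of (snd st') \<longrightarrow> (F q i j \<in> W) = (v \<in> W)) \<longrightarrow>
        (\<forall>l<7. \<forall>b \<in> {o1, o2, o3, o4}. (F b i j \<in> W) = (F l i j \<in> W))"
    using alg_Suc[OF Suc.prems] unfolding decomposes_def by (elim exE conjE) (rule that; assumption)
  have "expanding (edges_of (snd st')) (2 * 2 ^ k) {\<tau> 0..<\<tau> K} (comb (2 ^ k) (F o1) (F o2) (F o3) (F o4))"
  proof (rule expanding_comb[where Q = Q])
    fix l :: nat assume "l < 7"
    then obtain A B s s' where "alg k A B s = (F l, s')" "\<tau> l \<le> fst s" "fst s' \<le> \<tau> (Suc l)"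
      "set (snd s') \<subseteq> set (snd st')"
      using d(6) by blast
    then show "expanding (edges_of (snd st')) (2 ^ k) {\<tau> l..<\<tau> (Suc l)} (F l)"
      by (intro expanding_mono[OF Suc.IH] edges_of_mono) auto
  next
    show "\<forall>l<7. \<forall>b \<in> {o1, o2, o3, o4}. (F b i j \<in> W) = (F l i j \<in> W)"
      if "i < 2 ^ k" "j < 2 ^ k"
        "\<forall>q \<in> {..<7} \<union> Q. \<forall>v. (F q i j, v) \<in> edges_of (snd st') \<longrightarrow> (F q i j \<in> W) = (v \<in> W)"
      for i j W
      by (rule d(11)[THEN spec, THEN mp, THEN spec, THEN mp, THEN spec, THEN mp, OF that])
  qed (use d(4,5,7-10) in simp_all)
  then show ?case
    using d(1-3) by (auto elim: expanding_mono)
qed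

text \<open>Unfolding \<open>d\<close> levels leads to \<open>7 ^ d\<close> products of size
  \<open>2 ^ r\<close> on disjoint intervals, and \<open>U\<close> collects their outputs. The bound
  on \<open>q\<close> says that it is at most half the outputs of one such product.\<close>

lemma alg_small_set_expanding:
  assumes "2 * q \<le> 2 ^ r * 2 ^ r"
  shows "alg (r + d) A B st = (R, st') \<Longrightarrow>
    \<exists>U. small_set_expanding (edges_of (snd st')) {fst st..<fst st'} U q \<and> card U = 7 ^ d * 4 ^ r"
proof (induction d arbitrary: A B st R st')
  case 0
  then have e: "expanding (edges_of (snd st')) (2 ^ r) {fst st..<fst st'} R"
    using alg_expanding by simp
  have "card (outs (2 ^ r) R) = 4 ^ r"
    using e by (simp add: expanding_def outs_def card_image flip: power_mult_distrib)
  then show ?case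
    using expanding_imp_small_set_expanding[OF e _ assms] by auto
next
  case (Suc d)
  have "decomposes alg (r + d) st R st'"
    using Suc.prems by (intro alg_Suc) simp
  then obtain \<tau> F K where d: "fst st \<le> \<tau> 0" "\<tau> K \<le> fst st'" "7 \<le> (K::nat)"
    and mono: "\<forall>m<K. \<tau> m \<le> \<tau> (Suc m)"
    and calls: "\<forall>l<7. \<exists>A B s s'. alg (r + d) A B s = (F l, s') \<and> \<tau> l \<le> fst s \<and> fst s' \<le> \<tau> (Suc l) \<and>
        set (snd s') \<subseteq> set (snd st')"
    unfolding decomposes_def by (elim exE conjE) (rule that; assumption)
  note mono = mono[rule_format]
  let ?V = "\<lambda>l. {\<tau> l..<\<tau> (Suc l)}"
  have "\<exists>U. small_set_expanding (edges_of (snd st')) (?V l) U q \<and> card U = 7 ^ d * 4 ^ r" if l: "l < 7" for l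
  proof -
    obtain A B s s' where c: "alg (r + d) A B s = (F l, s')" "\<tau> l \<le> fst s" "fst s' \<le> \<tau> (Suc l)"
      "set (snd s') \<subseteq> set (snd st')"
      using calls l by blast
    obtain U where "small_set_expanding (edges_of (snd s')) {fst s..<fst s'} U q" "card U = 7 ^ d * 4 ^ r"
      using Suc.IH[OF c(1)] by blast
    moreover have "small_set_expanding (edges_of (snd st')) (?V l) U q"
      by (rule small_set_expanding_mono[OF calculation(1)]) (use c edges_of_mono in auto)
    ultimately show ?thesis by blast
  qed
  then obtain U where U: "\<And>l. l < 7 \<Longrightarrow> small_set_expanding (edges_of (snd st')) (?V l) (U l) q"
    "\<And>l. l < 7 \<Longrightarrow> card (U l) = 7 ^ d * 4 ^ r" by metis
  have disj: "?V l \<inter> ?V l' = {}" if "l < 7" "l' < 7" "l \<noteq> l'" for l l'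
    using interval_index_unique[of K \<tau> l l', OF mono] that d(3) by fastforce
  have "?V l \<subseteq> {fst st..<fst st'}" if "l < 7" for l
  proof -
    have "\<tau> 0 \<le> \<tau> l" "\<tau> (Suc l) \<le> \<tau> K"
      using that d(3) by (auto intro!: mono_upto[of K \<tau>] mono)
    then show ?thesis using d(1,2) by auto
  qed
  then have "(\<Union>l\<in>{..<7}. ?V l) \<subseteq> {fst st..<fst st'}" by blast
  moreover have "small_set_expanding (edges_of (snd st')) (\<Union>l\<in>{..<7}. ?V l) (\<Union>l\<in>{..<7}. U l) q"
    using disj U(1) by (intro small_set_expanding_UN) auto
  ultimately have "small_set_expanding (edges_of (snd st')) {fst st..<fst st'} (\<Union>l\<in>{..<7}. U l) q"
    by (elim small_set_expanding_mono) auto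
  moreover have "card (\<Union>l\<in>{..<7}. U l) = (\<Sum>l\<in>{..<7}. card (U l))"
  proof (rule card_UN_disjoint)
    have UV: "U l \<subseteq> ?V l" if "l < 7" for l
      using U(1)[OF that] by (simp add: small_set_expanding_def)
    then show "\<forall>l\<in>{..<7}. finite (U l)" by (meson finite_atLeastLessThan finite_subset lessThan_iff)
    show "\<forall>l\<in>{..<7}. \<forall>l'\<in>{..<7}. l \<noteq> l' \<longrightarrow> U l \<inter> U l' = {}"
      using UV disj by blast
  qed simp
  ultimately show ?case using U(2) by auto
qed

end

text \<open>Both claims are read off one trace of the generator and assume \<open>ext\<close> only
  one level below. So \<open>strassen_extends\<close> follows by induction from the first claim, and
  then discharges \<open>ext\<close> for the second.\<close>

lemma strassen_decomposes:
  assumes "strassen (Suc k) A B st0 = (R, st)"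
    and ext: "\<And>A B st R st'. strassen k A B st = (R, st') \<Longrightarrow> extends st st'"
  shows "extends st0 st \<and> decomposes strassen k st0 R st"
proof -
  let ?h = "2 ^ k :: nat"
  obtain X1 st1 where e1: "madd ?h (blk A ?h 0 0) (blk A ?h 1 1) st0 = (X1, st1)"
    by (rule that[OF surjective_pairing])
  obtain Y1 st2 where e2: "madd ?h (blk B ?h 0 0) (blk B ?h 1 1) st1 = (Y1, st2)"
    by (rule that[OF surjective_pairing])
  obtain M1 st3 where e3: "strassen k X1 Y1 st2 = (M1, st3)"
    by (rule that[OF surjective_pairing])
  obtain X2 st4 where e4: "madd ?h (blk A ?h 1 0) (blk A ?h 1 1) st3 = (X2, st4)"
    by (rule that[OF surjective_pairing])
  obtain M2 st5 where e5: "strassen k X2 (blk B ?h 0 0) st4 = (M2, st5)"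
    by (rule that[OF surjective_pairing])
  obtain Y3 st6 where e6: "madd ?h (blk B ?h 0 1) (blk B ?h 1 1) st5 = (Y3, st6)"
    by (rule that[OF surjective_pairing])
  obtain M3 st7 where e7: "strassen k (blk A ?h 0 0) Y3 st6 = (M3, st7)"
    by (rule that[OF surjective_pairing])
  obtain Y4 st8 where e8: "madd ?h (blk B ?h 1 0) (blk B ?h 0 0) st7 = (Y4, st8)"
    by (rule that[OF surjective_pairing])
  obtain M4 st9 where e9: "strassen k (blk A ?h 1 1) Y4 st8 = (M4, st9)"
    by (rule that[OF surjective_pairing])
  obtain X5 st10 where e10: "madd ?h (blk A ?h 0 0) (blk A ?h 0 1) st9 = (X5, st10)"
    by (rule that[OF surjective_pairing])
  obtain M5 st11 where e11: "strassen k X5 (blk B ?h 1 1) st10 = (M5, st11)"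
    by (rule that[OF surjective_pairing])
  obtain X6 st12 where e12: "madd ?h (blk A ?h 1 0) (blk A ?h 0 0) st11 = (X6, st12)"
    by (rule that[OF surjective_pairing])
  obtain Y6 st13 where e13: "madd ?h (blk B ?h 0 0) (blk B ?h 0 1) st12 = (Y6, st13)"
    by (rule that[OF surjective_pairing])
  obtain M6 st14 where e14: "strassen k X6 Y6 st13 = (M6, st14)"
    by (rule that[OF surjective_pairing])
  obtain X7 st15 where e15: "madd ?h (blk A ?h 0 1) (blk A ?h 1 1) st14 = (X7, st15)"
    by (rule that[OF surjective_pairing])
  obtain Y7 st16 where e16: "madd ?h (blk B ?h 1 0) (blk B ?h 1 1) st15 = (Y7, st16)"
    by (rule that[OF surjective_pairing])
  obtain M7 st17 where e17: "strassen k X7 Y7 st16 = (M7, st17)"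
    by (rule that[OF surjective_pairing])
  obtain P1 st18 where e18: "madd ?h M1 M4 st17 = (P1, st18)"
    by (rule that[OF surjective_pairing])
  obtain P2 st19 where e19: "madd ?h P1 M5 st18 = (P2, st19)"
    by (rule that[OF surjective_pairing])
  obtain C11 st20 where e20: "madd ?h P2 M7 st19 = (C11, st20)"
    by (rule that[OF surjective_pairing])
  obtain C12 st21 where e21: "madd ?h M3 M5 st20 = (C12, st21)"
    by (rule that[OF surjective_pairing])
  obtain C21 st22 where e22: "madd ?h M2 M4 st21 = (C21, st22)"
    by (rule that[OF surjective_pairing])
  obtain Q1 st23 where e23: "madd ?h M1 M2 st22 = (Q1, st23)"
    by (rule that[OF surjective_pairing])
  obtain Q2 st24 where e24: "madd ?h Q1 M3 st23 = (Q2, st24)"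
    by (rule that[OF surjective_pairing])
  obtain C22 st25 where e25: "madd ?h Q2 M6 st24 = (C22, st25)"
    by (rule that[OF surjective_pairing])
  note e = e1 e2 e3 e4 e5 e6 e7 e8 e9 e10 e11 e12 e13 e14 e15 e16 e17 e18 e19 e20 e21 e22 e23 e24 e25
  have R: "R = comb ?h C11 C12 C21 C22" "st = st25"
    using assms(1) by (simp_all add: Let_def e del: One_nat_def)
  note x = e1[THEN madd_extends] e2[THEN madd_extends] e3[THEN ext] e4[THEN madd_extends]
    e5[THEN ext] e6[THEN madd_extends] e7[THEN ext] e8[THEN madd_extends] e9[THEN ext]
    e10[THEN madd_extends] e11[THEN ext] e12[THEN madd_extends] e13[THEN madd_extends] e14[THEN ext]
    e15[THEN madd_extends] e16[THEN madd_extends] e17[THEN ext] e18[THEN madd_extends]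
    e19[THEN madd_extends] e20[THEN madd_extends] e21[THEN madd_extends] e22[THEN madd_extends]
    e23[THEN madd_extends] e24[THEN madd_extends] e25[THEN madd_extends]
  \<comment> \<open>The facts \<open>y25\<close> down to \<open>y0\<close> relate each state to the
    last one: operations recorded at any stage persist in the final list.\<close>
  have y25: "extends st25 st25" by (rule extends_refl)
  note y24 = extends_trans[OF x(25) y25]
  note y23 = extends_trans[OF x(24) y24]
  note y22 = extends_trans[OF x(23) y23]
  note y21 = extends_trans[OF x(22) y22]
  note y20 = extends_trans[OF x(21) y21]
  note y19 = extends_trans[OF x(20) y20]
  note y18 = extends_trans[OF x(19) y19]
  note y17 = extends_trans[OF x(18) y18]
  note y16 = extends_trans[OF x(17) y17]
  note y15 = extends_trans[OF x(16) y16]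
  note y14 = extends_trans[OF x(15) y15]
  note y13 = extends_trans[OF x(14) y14]
  note y12 = extends_trans[OF x(13) y13]
  note y11 = extends_trans[OF x(12) y12]
  note y10 = extends_trans[OF x(11) y11]
  note y9 = extends_trans[OF x(10) y10]
  note y8 = extends_trans[OF x(9) y9]
  note y7 = extends_trans[OF x(8) y8]
  note y6 = extends_trans[OF x(7) y7]
  note y5 = extends_trans[OF x(6) y6]
  note y4 = extends_trans[OF x(5) y5]
  note y3 = extends_trans[OF x(4) y4]
  note y2 = extends_trans[OF x(3) y3]
  note y1 = extends_trans[OF x(2) y2]
  note y0 = extends_trans[OF x(1) y1]
  \<comment> \<open>The boundaries from \<open>fst st2\<close> to \<open>fst st16\<close> are the
    starts of the seven products, so the operand sums of a product close the interval before it;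
    those of \<open>M1\<close> precede all intervals.\<close>
  let ?\<tau> = "(!) [fst st2, fst st4, fst st6, fst st8, fst st10, fst st13, fst st16, fst st17,
    fst st18, fst st19, fst st20, fst st21, fst st22, fst st23, fst st24, fst st25]"
  let ?F = "(!) [M1, M2, M3, M4, M5, M6, M7, P1, P2, C11, C12, C21, Q1, Q2, C22]"
  note le = x[THEN extends_fst]
  note m = e18[THEN madd_outs] e19[THEN madd_outs] e20[THEN madd_outs] e21[THEN madd_outs]
    e22[THEN madd_outs] e23[THEN madd_outs] e24[THEN madd_outs] e25[THEN madd_outs]
  have dec: "decomposes strassen k st0 R st"
    unfolding decomposes_def R
  \<comment> \<open>Seven products and eight sums make 15 blocks. Indices 7, 8, 12, 13 are
    \<open>P1\<close>, \<open>P2\<close>, \<open>Q1\<close>, \<open>Q2\<close>; indices 9, 10, 11,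
    14 are \<open>C11\<close>, \<open>C12\<close>, \<open>C21\<close>, \<open>C22\<close>.\<close>
  proof (rule exI[of _ ?\<tau>], rule exI[of _ ?F], rule exI[of _ "15::nat"],
      rule exI[of _ "{7, 8, 12, 13}::nat set"],
      rule exI[of _ "9::nat"], rule exI[of _ "10::nat"], rule exI[of _ "11::nat"], rule exI[of _ "14::nat"], intro conjI)
    show "\<forall>m<15. ?\<tau> m \<le> ?\<tau> (Suc m)"
      using le by (simp add: all_less_numeral)
    show "\<forall>m<15. 7 \<le> m \<longrightarrow> outs ?h (?F m) \<subseteq> {?\<tau> m..<?\<tau> (Suc m)} \<and>
        inj_on (case_prod (?F m)) (sq ?h)"
      using m by (simp add: all_less_numeral)
    show "\<forall>l<7. \<exists>A B s s'. strassen k A B s = (?F l, s') \<and> ?\<tau> l \<le> fst s \<and> fst s' \<le> ?\<tau> (Suc l) \<and>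
        set (snd s') \<subseteq> set (snd st25)"
    proof -
      have r1: "\<exists>A B s s'. strassen k A B s = (M1, s') \<and> fst st2 \<le> fst s \<and> fst s' \<le> fst st4
          \<and> set (snd s') \<subseteq> set (snd st25)"
        using e3 extends_set[OF y3] le by - (intro exI conjI, assumption, auto)
      have r2: "\<exists>A B s s'. strassen k A B s = (M2, s') \<and> fst st4 \<le> fst s \<and> fst s' \<le> fst st6
          \<and> set (snd s') \<subseteq> set (snd st25)"
        using e5 extends_set[OF y5] le by - (intro exI conjI, assumption, auto)
      have r3: "\<exists>A B s s'. strassen k A B s = (M3, s') \<and> fst st6 \<le> fst s \<and> fst s' \<le> fst st8
          \<and> set (snd s') \<subseteq> set (snd st25)"
        using e7 extends_set[OF y7] le by - (intro exI conjI, assumption, auto)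
      have r4: "\<exists>A B s s'. strassen k A B s = (M4, s') \<and> fst st8 \<le> fst s \<and> fst s' \<le> fst st10
          \<and> set (snd s') \<subseteq> set (snd st25)"
        using e9 extends_set[OF y9] le by - (intro exI conjI, assumption, auto)
      have r5: "\<exists>A B s s'. strassen k A B s = (M5, s') \<and> fst st10 \<le> fst s \<and> fst s' \<le> fst st13
          \<and> set (snd s') \<subseteq> set (snd st25)"
        using e11 extends_set[OF y11] le by - (intro exI conjI, assumption, auto)
      have r6: "\<exists>A B s s'. strassen k A B s = (M6, s') \<and> fst st13 \<le> fst s \<and> fst s' \<le> fst st16
          \<and> set (snd s') \<subseteq> set (snd st25)"
        using e14 extends_set[OF y14] le by - (intro exI conjI, assumption, auto)
      have r7: "\<exists>A B s s'. strassen k A B s = (M7, s') \<and> fst st16 \<le> fst s \<and> fst s' \<le> fst st17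
          \<and> set (snd s') \<subseteq> set (snd st25)"
        using e17 extends_set[OF y17] le by - (intro exI conjI, assumption, auto)
      show ?thesis using r1 r2 r3 r4 r5 r6 r7 by (simp add: all_less_numeral)
    qed
    show "\<forall>i<?h. \<forall>j<?h. \<forall>W. (\<forall>q\<in>{..<7} \<union> {7, 8, 12, 13}. \<forall>v. (?F q i j, v) \<in> edges_of (snd st25) \<longrightarrow>
          (?F q i j \<in> W) = (v \<in> W)) \<longrightarrow>
        (\<forall>l<7. \<forall>b\<in>{9, 10, 11, 14}. (?F b i j \<in> W) = (?F l i j \<in> W))"
    proof (rule allI, rule impI, rule allI, rule impI, rule allI, rule impI)
      fix i j W
      assume ij: "i < ?h" "j < ?h"
        and H: "\<forall>q\<in>{..<7} \<union> {7, 8, 12, 13}. \<forall>v. (?F q i j, v) \<in> edges_of (snd st25) \<longrightarrow>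
          (?F q i j \<in> W) = (v \<in> W)"
      have H':
        "\<And>v. (M1 i j, v) \<in> edges_of (snd st25) \<Longrightarrow> (M1 i j \<in> W) = (v \<in> W)"
        "\<And>v. (M2 i j, v) \<in> edges_of (snd st25) \<Longrightarrow> (M2 i j \<in> W) = (v \<in> W)"
        "\<And>v. (M3 i j, v) \<in> edges_of (snd st25) \<Longrightarrow> (M3 i j \<in> W) = (v \<in> W)"
        "\<And>v. (M4 i j, v) \<in> edges_of (snd st25) \<Longrightarrow> (M4 i j \<in> W) = (v \<in> W)"
        "\<And>v. (M5 i j, v) \<in> edges_of (snd st25) \<Longrightarrow> (M5 i j \<in> W) = (v \<in> W)"
        "\<And>v. (M6 i j, v) \<in> edges_of (snd st25) \<Longrightarrow> (M6 i j \<in> W) = (v \<in> W)"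
        "\<And>v. (M7 i j, v) \<in> edges_of (snd st25) \<Longrightarrow> (M7 i j \<in> W) = (v \<in> W)"
        "\<And>v. (P1 i j, v) \<in> edges_of (snd st25) \<Longrightarrow> (P1 i j \<in> W) = (v \<in> W)"
        "\<And>v. (P2 i j, v) \<in> edges_of (snd st25) \<Longrightarrow> (P2 i j \<in> W) = (v \<in> W)"
        "\<And>v. (Q1 i j, v) \<in> edges_of (snd st25) \<Longrightarrow> (Q1 i j \<in> W) = (v \<in> W)"
        "\<And>v. (Q2 i j, v) \<in> edges_of (snd st25) \<Longrightarrow> (Q2 i j \<in> W) = (v \<in> W)"
        using H by (simp_all add: all_less_numeral)
      \<comment> \<open>These edges connect the gadget: \<open>C11\<close> is linked through
        \<open>P2\<close> and \<open>P1\<close> to \<open>M1\<close>, \<open>M4\<close>,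
        \<open>M5\<close>, \<open>M7\<close>; \<open>C12\<close> shares \<open>M5\<close> and adds
        \<open>M3\<close>; \<open>C21\<close> shares \<open>M4\<close> and adds \<open>M2\<close>;
        \<open>C22\<close>, through \<open>Q2\<close> and \<open>Q1\<close>, shares
        \<open>M1\<close> and adds \<open>M6\<close>.\<close>
      note eqs = H'(1)[OF madd_edges(1)[OF e18 y18 ij]]
        H'(4)[OF madd_edges(2)[OF e18 y18 ij]]
        H'(8)[OF madd_edges(1)[OF e19 y19 ij]]
        H'(5)[OF madd_edges(2)[OF e19 y19 ij]]
        H'(9)[OF madd_edges(1)[OF e20 y20 ij]]
        H'(7)[OF madd_edges(2)[OF e20 y20 ij]]
        H'(3)[OF madd_edges(1)[OF e21 y21 ij]]
        H'(5)[OF madd_edges(2)[OF e21 y21 ij]]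
        H'(2)[OF madd_edges(1)[OF e22 y22 ij]]
        H'(4)[OF madd_edges(2)[OF e22 y22 ij]]
        H'(1)[OF madd_edges(1)[OF e23 y23 ij]]
        H'(2)[OF madd_edges(2)[OF e23 y23 ij]]
        H'(10)[OF madd_edges(1)[OF e24 y24 ij]]
        H'(3)[OF madd_edges(2)[OF e24 y24 ij]]
        H'(11)[OF madd_edges(1)[OF e25 y25 ij]]
        H'(6)[OF madd_edges(2)[OF e25 y25 ij]]
      show "\<forall>l<7. \<forall>b\<in>{9, 10, 11, 14}. (?F b i j \<in> W) = (?F l i j \<in> W)"
        using eqs by (simp add: all_less_numeral)
    qed
  qed (use le in auto)
  then show ?thesis using y0 R(2) by simp
qed

lemma winograd_decomposes:
  assumes "winograd (Suc k) A B st0 = (R, st)"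
    and ext: "\<And>A B st R st'. winograd k A B st = (R, st') \<Longrightarrow> extends st st'"
  shows "extends st0 st \<and> decomposes winograd k st0 R st"
proof -
  let ?h = "2 ^ k :: nat"
  obtain S1 st1 where e1: "madd ?h (blk A ?h 1 0) (blk A ?h 1 1) st0 = (S1, st1)"
    by (rule that[OF surjective_pairing])
  obtain S2 st2 where e2: "madd ?h S1 (blk A ?h 0 0) st1 = (S2, st2)"
    by (rule that[OF surjective_pairing])
  obtain S3 st3 where e3: "madd ?h (blk A ?h 0 0) (blk A ?h 1 0) st2 = (S3, st3)"
    by (rule that[OF surjective_pairing])
  obtain S4 st4 where e4: "madd ?h (blk A ?h 0 1) S2 st3 = (S4, st4)"
    by (rule that[OF surjective_pairing])
  obtain T1 st5 where e5: "madd ?h (blk B ?h 0 1) (blk B ?h 0 0) st4 = (T1, st5)"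
    by (rule that[OF surjective_pairing])
  obtain T2 st6 where e6: "madd ?h (blk B ?h 1 1) T1 st5 = (T2, st6)"
    by (rule that[OF surjective_pairing])
  obtain T3 st7 where e7: "madd ?h (blk B ?h 1 1) (blk B ?h 0 1) st6 = (T3, st7)"
    by (rule that[OF surjective_pairing])
  obtain T4 st8 where e8: "madd ?h T2 (blk B ?h 1 0) st7 = (T4, st8)"
    by (rule that[OF surjective_pairing])
  obtain M1 st9 where e9: "winograd k (blk A ?h 0 0) (blk B ?h 0 0) st8 = (M1, st9)"
    by (rule that[OF surjective_pairing])
  obtain M2 st10 where e10: "winograd k (blk A ?h 0 1) (blk B ?h 1 0) st9 = (M2, st10)"
    by (rule that[OF surjective_pairing])
  obtain M3 st11 where e11: "winograd k S4 (blk B ?h 1 1) st10 = (M3, st11)"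
    by (rule that[OF surjective_pairing])
  obtain M4 st12 where e12: "winograd k (blk A ?h 1 1) T4 st11 = (M4, st12)"
    by (rule that[OF surjective_pairing])
  obtain M5 st13 where e13: "winograd k S1 T1 st12 = (M5, st13)"
    by (rule that[OF surjective_pairing])
  obtain M6 st14 where e14: "winograd k S2 T2 st13 = (M6, st14)"
    by (rule that[OF surjective_pairing])
  obtain M7 st15 where e15: "winograd k S3 T3 st14 = (M7, st15)"
    by (rule that[OF surjective_pairing])
  obtain U1 st16 where e16: "madd ?h M1 M2 st15 = (U1, st16)"
    by (rule that[OF surjective_pairing])
  obtain U2 st17 where e17: "madd ?h M1 M6 st16 = (U2, st17)"
    by (rule that[OF surjective_pairing])
  obtain U3 st18 where e18: "madd ?h U2 M7 st17 = (U3, st18)"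
    by (rule that[OF surjective_pairing])
  obtain U4 st19 where e19: "madd ?h U2 M5 st18 = (U4, st19)"
    by (rule that[OF surjective_pairing])
  obtain U5 st20 where e20: "madd ?h U4 M3 st19 = (U5, st20)"
    by (rule that[OF surjective_pairing])
  obtain U6 st21 where e21: "madd ?h U3 M4 st20 = (U6, st21)"
    by (rule that[OF surjective_pairing])
  obtain U7 st22 where e22: "madd ?h U3 M5 st21 = (U7, st22)"
    by (rule that[OF surjective_pairing])
  note e = e1 e2 e3 e4 e5 e6 e7 e8 e9 e10 e11 e12 e13 e14 e15 e16 e17 e18 e19 e20 e21 e22
  have R: "R = comb ?h U1 U5 U6 U7" "st = st22"
    using assms(1) by (simp_all add: Let_def e del: One_nat_def)
  note x = e1[THEN madd_extends] e2[THEN madd_extends] e3[THEN madd_extends] e4[THEN madd_extends]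
    e5[THEN madd_extends] e6[THEN madd_extends] e7[THEN madd_extends] e8[THEN madd_extends]
    e9[THEN ext] e10[THEN ext] e11[THEN ext] e12[THEN ext] e13[THEN ext] e14[THEN ext] e15[THEN ext]
    e16[THEN madd_extends] e17[THEN madd_extends] e18[THEN madd_extends] e19[THEN madd_extends]
    e20[THEN madd_extends] e21[THEN madd_extends] e22[THEN madd_extends]
  have y22: "extends st22 st22" by (rule extends_refl)
  note y21 = extends_trans[OF x(22) y22]
  note y20 = extends_trans[OF x(21) y21]
  note y19 = extends_trans[OF x(20) y20]
  note y18 = extends_trans[OF x(19) y19]
  note y17 = extends_trans[OF x(18) y18]
  note y16 = extends_trans[OF x(17) y17]
  note y15 = extends_trans[OF x(16) y16]
  note y14 = extends_trans[OF x(15) y15]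
  note y13 = extends_trans[OF x(14) y14]
  note y12 = extends_trans[OF x(13) y13]
  note y11 = extends_trans[OF x(12) y12]
  note y10 = extends_trans[OF x(11) y11]
  note y9 = extends_trans[OF x(10) y10]
  note y8 = extends_trans[OF x(9) y9]
  note y7 = extends_trans[OF x(8) y8]
  note y6 = extends_trans[OF x(7) y7]
  note y5 = extends_trans[OF x(6) y6]
  note y4 = extends_trans[OF x(5) y5]
  note y3 = extends_trans[OF x(4) y4]
  note y2 = extends_trans[OF x(3) y3]
  note y1 = extends_trans[OF x(2) y2]
  note y0 = extends_trans[OF x(1) y1]
  \<comment> \<open>All operand sums precede the first product, so the intervals start at
    \<open>fst st8\<close> and have no slack.\<close>
  let ?\<tau> = "(!) [fst st8, fst st9, fst st10, fst st11, fst st12, fst st13, fst st14, fst st15,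
    fst st16, fst st17, fst st18, fst st19, fst st20, fst st21, fst st22]"
  let ?F = "(!) [M1, M2, M3, M4, M5, M6, M7, U1, U2, U3, U4, U5, U6, U7]"
  note le = x[THEN extends_fst]
  note m = e16[THEN madd_outs] e17[THEN madd_outs] e18[THEN madd_outs] e19[THEN madd_outs]
    e20[THEN madd_outs] e21[THEN madd_outs] e22[THEN madd_outs]
  have dec: "decomposes winograd k st0 R st"
    unfolding decomposes_def R
  \<comment> \<open>Indices 8, 9, 10 are the intermediate sums \<open>U2\<close>, \<open>U3\<close>,
    \<open>U4\<close>; indices 7, 11, 12, 13 are the output blocks \<open>U1\<close>,
    \<open>U5\<close>, \<open>U6\<close>, \<open>U7\<close>.\<close>
  proof (rule exI[of _ ?\<tau>], rule exI[of _ ?F], rule exI[of _ "14::nat"],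
      rule exI[of _ "{8, 9, 10}::nat set"],
      rule exI[of _ "7::nat"], rule exI[of _ "11::nat"], rule exI[of _ "12::nat"], rule exI[of _ "13::nat"], intro conjI)
    show "\<forall>m<14. ?\<tau> m \<le> ?\<tau> (Suc m)"
      using le by (simp add: all_less_numeral)
    show "\<forall>m<14. 7 \<le> m \<longrightarrow> outs ?h (?F m) \<subseteq> {?\<tau> m..<?\<tau> (Suc m)} \<and>
        inj_on (case_prod (?F m)) (sq ?h)"
      using m by (simp add: all_less_numeral)
    show "\<forall>l<7. \<exists>A B s s'. winograd k A B s = (?F l, s') \<and> ?\<tau> l \<le> fst s \<and> fst s' \<le> ?\<tau> (Suc l) \<and>
        set (snd s') \<subseteq> set (snd st22)"
    proof -
      have r1: "\<exists>A B s s'. winograd k A B s = (M1, s') \<and> fst st8 \<le> fst s \<and> fst s' \<le> fst st9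
          \<and> set (snd s') \<subseteq> set (snd st22)"
        using e9 extends_set[OF y9] le by - (intro exI conjI, assumption, auto)
      have r2: "\<exists>A B s s'. winograd k A B s = (M2, s') \<and> fst st9 \<le> fst s \<and> fst s' \<le> fst st10
          \<and> set (snd s') \<subseteq> set (snd st22)"
        using e10 extends_set[OF y10] le by - (intro exI conjI, assumption, auto)
      have r3: "\<exists>A B s s'. winograd k A B s = (M3, s') \<and> fst st10 \<le> fst s \<and> fst s' \<le> fst st11
          \<and> set (snd s') \<subseteq> set (snd st22)"
        using e11 extends_set[OF y11] le by - (intro exI conjI, assumption, auto)
      have r4: "\<exists>A B s s'. winograd k A B s = (M4, s') \<and> fst st11 \<le> fst s \<and> fst s' \<le> fst st12
          \<and> set (snd s') \<subseteq> set (snd st22)"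
        using e12 extends_set[OF y12] le by - (intro exI conjI, assumption, auto)
      have r5: "\<exists>A B s s'. winograd k A B s = (M5, s') \<and> fst st12 \<le> fst s \<and> fst s' \<le> fst st13
          \<and> set (snd s') \<subseteq> set (snd st22)"
        using e13 extends_set[OF y13] le by - (intro exI conjI, assumption, auto)
      have r6: "\<exists>A B s s'. winograd k A B s = (M6, s') \<and> fst st13 \<le> fst s \<and> fst s' \<le> fst st14
          \<and> set (snd s') \<subseteq> set (snd st22)"
        using e14 extends_set[OF y14] le by - (intro exI conjI, assumption, auto)
      have r7: "\<exists>A B s s'. winograd k A B s = (M7, s') \<and> fst st14 \<le> fst s \<and> fst s' \<le> fst st15
          \<and> set (snd s') \<subseteq> set (snd st22)"
        using e15 extends_set[OF y15] le by - (intro exI conjI, assumption, auto)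
      show ?thesis using r1 r2 r3 r4 r5 r6 r7 by (simp add: all_less_numeral)
    qed
    show "\<forall>i<?h. \<forall>j<?h. \<forall>W. (\<forall>q\<in>{..<7} \<union> {8, 9, 10}. \<forall>v. (?F q i j, v) \<in> edges_of (snd st22) \<longrightarrow>
          (?F q i j \<in> W) = (v \<in> W)) \<longrightarrow>
        (\<forall>l<7. \<forall>b\<in>{7, 11, 12, 13}. (?F b i j \<in> W) = (?F l i j \<in> W))"
    proof (rule allI, rule impI, rule allI, rule impI, rule allI, rule impI)
      fix i j W
      assume ij: "i < ?h" "j < ?h"
        and H: "\<forall>q\<in>{..<7} \<union> {8, 9, 10}. \<forall>v. (?F q i j, v) \<in> edges_of (snd st22) \<longrightarrow>
          (?F q i j \<in> W) = (v \<in> W)"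
      have H':
        "\<And>v. (M1 i j, v) \<in> edges_of (snd st22) \<Longrightarrow> (M1 i j \<in> W) = (v \<in> W)"
        "\<And>v. (M2 i j, v) \<in> edges_of (snd st22) \<Longrightarrow> (M2 i j \<in> W) = (v \<in> W)"
        "\<And>v. (M3 i j, v) \<in> edges_of (snd st22) \<Longrightarrow> (M3 i j \<in> W) = (v \<in> W)"
        "\<And>v. (M4 i j, v) \<in> edges_of (snd st22) \<Longrightarrow> (M4 i j \<in> W) = (v \<in> W)"
        "\<And>v. (M5 i j, v) \<in> edges_of (snd st22) \<Longrightarrow> (M5 i j \<in> W) = (v \<in> W)"
        "\<And>v. (M6 i j, v) \<in> edges_of (snd st22) \<Longrightarrow> (M6 i j \<in> W) = (v \<in> W)"
        "\<And>v. (M7 i j, v) \<in> edges_of (snd st22) \<Longrightarrow> (M7 i j \<in> W) = (v \<in> W)"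
        "\<And>v. (U2 i j, v) \<in> edges_of (snd st22) \<Longrightarrow> (U2 i j \<in> W) = (v \<in> W)"
        "\<And>v. (U3 i j, v) \<in> edges_of (snd st22) \<Longrightarrow> (U3 i j \<in> W) = (v \<in> W)"
        "\<And>v. (U4 i j, v) \<in> edges_of (snd st22) \<Longrightarrow> (U4 i j \<in> W) = (v \<in> W)"
        using H by (simp_all add: all_less_numeral)
      \<comment> \<open>\<open>U2\<close> is linked to \<open>M1\<close>, \<open>M6\<close>,
        \<open>U3\<close> and \<open>U4\<close>, and through the last two to \<open>M3\<close>,
        \<open>M4\<close>, \<open>M5\<close>, \<open>M7\<close> and the outputs \<open>U5\<close>,
        \<open>U6\<close>, \<open>U7\<close>. \<open>U1\<close> is attached through
        \<open>M1\<close> and adds \<open>M2\<close>.\<close>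
      note eqs = H'(1)[OF madd_edges(1)[OF e16 y16 ij]]
        H'(2)[OF madd_edges(2)[OF e16 y16 ij]]
        H'(1)[OF madd_edges(1)[OF e17 y17 ij]]
        H'(6)[OF madd_edges(2)[OF e17 y17 ij]]
        H'(8)[OF madd_edges(1)[OF e18 y18 ij]]
        H'(7)[OF madd_edges(2)[OF e18 y18 ij]]
        H'(8)[OF madd_edges(1)[OF e19 y19 ij]]
        H'(5)[OF madd_edges(2)[OF e19 y19 ij]]
        H'(10)[OF madd_edges(1)[OF e20 y20 ij]]
        H'(3)[OF madd_edges(2)[OF e20 y20 ij]]
        H'(9)[OF madd_edges(1)[OF e21 y21 ij]]
        H'(4)[OF madd_edges(2)[OF e21 y21 ij]]
        H'(9)[OF madd_edges(1)[OF e22 y22 ij]]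
        H'(5)[OF madd_edges(2)[OF e22 y22 ij]]
      show "\<forall>l<7. \<forall>b\<in>{7, 11, 12, 13}. (?F b i j \<in> W) = (?F l i j \<in> W)"
        using eqs by (simp add: all_less_numeral)
    qed
  qed (use le in auto)
  then show ?thesis using y0 R(2) by simp
qed

section \<open>The two algorithms as instances\<close>

lemma strassen_extends: "strassen k A B st = (R, st') \<Longrightarrow> extends st st'"
proof (induction k arbitrary: A B st R st')
  case 0
  then show ?case by (auto split: prod.splits intro: binop_extends)
next
  case (Suc k)
  show ?case using strassen_decomposes[OF Suc.prems Suc.IH] by simp
qed

lemma winograd_extends: "winograd k A B st = (R, st') \<Longrightarrow> extends st st'"
proof (induction k arbitrary: A B st R st')
  case 0
  then show ?case by (auto split: prod.splits intro: binop_extends)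
next
  case (Suc k)
  show ?case using winograd_decomposes[OF Suc.prems Suc.IH] by simp
qed

interpretation strassen: seven_product_scheme strassen
proof
  show "R 0 0 \<in> {fst st..<fst st'}" if "strassen 0 A B st = (R, st')" for A B st R st'
    using that by (auto simp: binop_def)
  show "decomposes strassen k st R st'" if "strassen (Suc k) A B st = (R, st')" for k A B st R st'
    using strassen_decomposes[OF that strassen_extends] by simp
qed (rule strassen_extends)

interpretation winograd: seven_product_scheme winograd
proof
  show "R 0 0 \<in> {fst st..<fst st'}" if "winograd 0 A B st = (R, st')" for A B st R st'
    using that by (auto simp: binop_def)
  show "decomposes winograd k st R st'" if "winograd (Suc k) A B st = (R, st')" for k A B st R st'
    using winograd_decomposes[OF that winograd_extends] by simp
qed (rule winograd_extends)

section \<open>The lower bound\<close>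

text \<open>The \<open>7 ^ d\<close> products of size \<open>2 ^ r\<close> have
  \<open>7 ^ d * 4 ^ r\<close> outputs together, enough for \<open>2 * 7 ^ d\<close> segments of
  \<open>q\<close> outputs, each of which costs at least \<open>M\<close> words.\<close>

lemma (in seven_product_scheme) io_cost_ge:
  assumes valid: "valid_impl (mk_cdag alg (r + d)) M sch"
    and q: "2 * q = 4 ^ r" "12 * M \<le> q"
  shows "2 * 7 ^ d * M \<le> io_cost sch"
proof -
  let ?n = "2 ^ (r + d) :: nat"
  let ?in = "{..<2 * ?n * ?n}"
  obtain R st' where a: "alg (r + d) (\<lambda>i j. i * ?n + j) (\<lambda>i j. ?n * ?n + i * ?n + j) (2 * ?n * ?n, []) = (R, st')"
    by (rule that[OF surjective_pairing])
  let ?G = "mk_cdag alg (r + d)"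
  let ?E = "edges_of (snd st')"
  have G: "fst ?G = ?in" "fst (snd ?G) = snd st'"
    by (simp_all add: mk_cdag_def a Let_def)
  have ops: "map fst (snd st') = rev [2 * ?n * ?n..<fst st']"
    using alg_extends[OF a] by (simp add: extends_def)
  then interpret cdag_schedule ?G M
    by unfold_locales (simp only: G distinct_rev distinct_upt)
  have vs: "fst ` set (snd st') = {2 * ?n * ?n..<fst st'}"
    using arg_cong[OF ops, of set] by simp
  have heads: "v \<in> {2 * ?n * ?n..<fst st'}" if "(a, v) \<in> ?E" for a v
    using that unfolding vs[symmetric] by (force simp: edges_of_def)
  obtain F S D where run: "run ?G M sch ({}, ?in, ?in) = Some (F, S, D)"
    and comp: "\<forall>(v, u1, u2) \<in> set (snd st'). v \<in> D"
    using valid unfolding valid_impl_def G by blast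
  have D: "{2 * ?n * ?n..<fst st'} \<subseteq> D"
    using comp unfolding vs[symmetric] by force
  \<comment> \<open>No edge ends in an input, so the set of inputs is closed under operands.\<close>
  have c: "consistent ({}, ?in, ?in)"
    unfolding consistent_def G using heads by fastforce
  have "2 * q \<le> 2 ^ r * 2 ^ r"
    using q(1) by (simp flip: power_mult_distrib)
  then obtain U where U: "small_set_expanding ?E {2 * ?n * ?n..<fst st'} U q" "card U = 7 ^ d * 4 ^ r"
    using alg_small_set_expanding[OF _ a] by auto
  then have UV: "U \<subseteq> {2 * ?n * ?n..<fst st'}"
    by (simp add: small_set_expanding_def)
  then have "finite U" by (rule finite_subset) simp
  moreover have "U \<inter> (D - ?in) = U"
    using UV D by fastforce
  then have "(2 * 7 ^ d) * q \<le> card (U \<inter> (D - ?in))"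
    using U(2) q(1) by simp
  moreover have "v \<in> D" if "(a, v) \<in> E" for a v
    using that heads D unfolding G by blast
  ultimately show ?thesis
    using io_lower_bound[OF run c _ _ q(2), of _ U "2 * 7 ^ d"] U(1) unfolding G by blast
qed

text \<open>The least \<open>r\<close> with \<open>24 * M \<le> 4 ^ r\<close> makes
  \<open>q = 4 ^ r / 2\<close> at least \<open>12 * M\<close>, and minimality gives
  \<open>4 ^ r \<le> 96 * M\<close>. Hence \<open>7 ^ r\<close> is at most
  \<open>(96 * M) powr (log 2 7 / 2)\<close>, and \<open>7 ^ d = 7 ^ k / 7 ^ r\<close> has the
  required order.\<close>

lemma (in seven_product_scheme) io_cost_powr_bound:
  assumes valid: "valid_impl (mk_cdag alg k) M sch" and M: "M \<ge> 1"
    and k: "real (2 ^ k) \<ge> 5 * sqrt (real M)"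
  shows "real (io_cost sch) \<ge>
    (1 / 96) powr (log 2 7 / 2) * (real (2 ^ k) / sqrt (real M)) powr (log 2 7) * real M"
proof -
  let ?p = "log 2 7 / 2 :: real"
  \<comment> \<open>The factor 5 serves because its square is at least 24; it ensures that
    \<open>r\<close> exists and is at most \<open>k\<close>.\<close>
  have "24 * real M \<le> (5 * sqrt (real M))\<^sup>2"
    by (simp add: power_mult_distrib)
  also have "\<dots> \<le> (real (2 ^ k))\<^sup>2"
    using k by (intro power_mono) auto
  also have "\<dots> = real (4 ^ k)"
    by (simp add: power2_eq_square flip: power_mult_distrib)
  finally have ex: "24 * M \<le> 4 ^ k" by linarith
  define r where "r = (LEAST r. 24 * M \<le> 4 ^ r)"
  have r: "24 * M \<le> 4 ^ r"
    unfolding r_def using ex by (rule LeastI)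
  have "r \<le> k"
    unfolding r_def using ex by (rule Least_le)
  then obtain d where d: "k = r + d" using le_Suc_ex by blast
  \<comment> \<open>The predecessor \<open>r'\<close> of \<open>r\<close> yields the integer
    \<open>2 * 4 ^ r'\<close> as half of \<open>4 ^ r\<close> and, by minimality, the upper bound on
    \<open>4 ^ r\<close>.\<close>
  have "r \<noteq> 0" using r M by (intro notI) simp
  then obtain r' where r': "r = Suc r'" using not0_implies_Suc by blast
  then have "\<not> 24 * M \<le> 4 ^ r'"
    unfolding r_def by (metis lessI not_less_Least)
  then have lt: "4 ^ r \<le> 96 * M" unfolding r' by simp
  have io: "2 * 7 ^ d * M \<le> io_cost sch"
    using valid r by (intro io_cost_ge[of r d M sch "2 * 4 ^ r'"]) (auto simp: d r')
  \<comment> \<open>The exponent \<open>log 2 7\<close> turns powers of 2 into powers of 7; its half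
    \<open>?p\<close> does the same for powers of 4.\<close>
  have sq4: "(2 ^ m :: real) powr log 2 7 = 7 ^ m" for m
    by (simp add: powr_realpow[symmetric] powr_powr mult.commute[of "real m"])
      (simp add: powr_powr[symmetric] powr_realpow)
  have p4: "(4 ^ m :: real) powr ?p = 7 ^ m" for m
  proof -
    have e: "(4 ^ m :: real) = (2 ^ m) powr 2"
      by (simp add: power2_eq_square flip: power_mult_distrib)
    show ?thesis unfolding e powr_powr by (simp add: sq4)
  qed
  have "(7::real) ^ r = (4 ^ r) powr ?p" by (simp only: p4)
  also have "\<dots> \<le> (96 * real M) powr ?p"
    using lt by (intro powr_mono2) (auto simp flip: of_nat_le_iff[where 'a = real])
  finally have r7: "(7::real) ^ r \<le> 96 powr ?p * real M powr ?p"
    by (simp add: powr_mult)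
  have "(real (2 ^ k) / sqrt (real M)) powr (log 2 7) = 7 ^ k / real M powr ?p"
    using M by (simp add: powr_divide sq4 powr_half_sqrt[symmetric] powr_powr)
  also have "\<dots> \<le> 7 ^ d * (96 powr ?p * real M powr ?p) / real M powr ?p"
    using r7 by (intro divide_right_mono) (auto simp: d power_add mult.commute intro: mult_left_mono)
  also have "\<dots> = 7 ^ d * 96 powr ?p" using M by simp
  finally have "(1 / 96) powr ?p * (real (2 ^ k) / sqrt (real M)) powr (log 2 7)
      \<le> (1 / 96) powr ?p * (7 ^ d * 96 powr ?p)"
    by (intro mult_left_mono) auto
  also have "\<dots> = 7 ^ d" by (simp add: powr_divide)
  finally have "(1 / 96) powr ?p * (real (2 ^ k) / sqrt (real M)) powr (log 2 7) * real M \<le> 7 ^ d * real M"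
    by (intro mult_right_mono) auto
  also have "\<dots> \<le> 2 * 7 ^ d * real M" by simp
  also have "\<dots> = real (2 * 7 ^ d * M)" by simp
  also have "\<dots> \<le> real (io_cost sch)" using io by (rule of_nat_mono)
  finally show ?thesis by simp
qed

theorem mainTheorem1:
  shows "\<exists>(c::real) (c0::real). c > 0 \<and> c0 \<ge> 1 \<and>
    (\<forall>(M::nat) (k::nat) sch. M \<ge> 1 \<longrightarrow> real (2 ^ k) \<ge> c0 * sqrt (real M) \<longrightarrow>
       (valid_impl (strassen_cdag k) M sch \<or> valid_impl (winograd_cdag k) M sch) \<longrightarrow>
       real (io_cost sch) \<ge> c * (real (2 ^ k) / sqrt (real M)) powr (log 2 7) * real M)"
  unfolding strassen_cdag_def winograd_cdag_def
  by (intro exI[of _ "(1 / 96) powr (log 2 7 / 2)"] exI[of _ "5"])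
    (auto intro: strassen.io_cost_powr_bound winograd.io_cost_powr_bound simp del: of_nat_power)

end
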